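(* Let $G=\langle h_1,\ldots,h_m\rangle$ be a rational semigroup. When $m=1$, assume that $h_1$ is neither the identity nor an elliptic Möbius transformation. Suppose that $G$ satisfies the open set condition with an open set $U$ with respect to the generator system $\{h_1,\ldots,h_m\}$, and suppose also that $J(G)\ne\overline U$. Then there exists a non-empty open set $V$ included in $U\cap F(G)$ such that, for almost every $x\in V$ with respect to the two-dimensional Lebesgue measure, $S(2,x)<\infty$. In particular, $s_0(G)\le2$.
   Context: $\overline{\mathbb{C}}$ is the Riemann sphere. A rational semigroup is a semigroup of non-constant rational maps of $\overline{\mathbb{C}}$ under composition; $\langle h_1,\dots,h_m\rangle$ is the one generated by $h_1,\dots,h_m$. $F(G)$ is the set of $z\in\overline{\mathbb{C}}$ having a neighborhood on which $G$ is normal; $J(G)=\overline{\mathbb{C}}\setminus F(G)$. $G=\langle h_1,\dots,h_m\rangle$ satisfies the open set condition with a non-empty open set $U\subset\overline{\mathbb{C}}$ with respect to $\{h_1,\dots,h_m\}$ if $h_j^{-1}(U)\subset U$ for each $j=1,\dots,m$ and the sets $h_j^{-1}(U)$, $j=1,\dots,m$, are mutually disjoint. For a countable rational semigroup $G$, $x\in\overline{\mathbb{C}}$ and $s\in\mathbb{R}$, let $S(s,x)=\sum_{g\in G}\sum_{g(y)=x}\|g'(y)\|^{-s}$, counting multiplicities, where $\|\cdot\|$ is the norm of the derivative with respect to the spherical metric; $S(x)=\inf\{s: S(s,x)<\infty\}$ (and $S(x)=\infty$ if there is no such $s$); $s_0(G)=\inf\{S(x):x\in\overline{\mathbb{C}}\}$.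 *)

theory Defs
  imports "HOL-Complex_Analysis.Complex_Analysis" "HOL-Computational_Algebra.Computational_Algebra"
begin

section \<open>The Riemann sphere\<close>

datatype riemann_sphere = Fin complex | Infty

text \<open>Stereographic embedding onto the unit sphere of \<open>\<complex> \<times> \<real>\<close>, regarded as Euclidean 3-space.\<close>

fun stereo :: "riemann_sphere \<Rightarrow> complex \<times> real" where
  "stereo (Fin z) = ((2 / (1 + (cmod z)\<^sup>2)) *\<^sub>R z, ((cmod z)\<^sup>2 - 1) / ((cmod z)\<^sup>2 + 1))"
| "stereo Infty = (0, 1)"

lemma stereo_snd_less_1: "snd (stereo (Fin z)) < 1"
proof -
  have "(cmod z)\<^sup>2 + 1 > 0" by (simp add: add_nonneg_pos)
  then show ?thesis by (simp add: divide_less_eq)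
qed

lemma inj_stereo: "inj stereo"
proof (rule injI)
  fix p q assume eq: "stereo p = stereo q"
  show "p = q"
  proof (cases p; cases q)
    fix z w assume p: "p = Fin z" and q: "q = Fin w"
    define a b where "a = 1 + (cmod z)\<^sup>2" and "b = 1 + (cmod w)\<^sup>2"
    have pos: "a > 0" "b > 0" by (simp_all add: a_def b_def add_pos_nonneg)
    have "(a - 2) / a = (b - 2) / b"
      using eq p q by (simp add: a_def b_def add.commute)
    then have ab: "a = b" using pos by (simp add: field_simps)
    have "(2 / a) *\<^sub>R z = (2 / b) *\<^sub>R w" using eq p q by (simp add: a_def b_def)
    then show "p = q" using ab pos p q by simp
  next
    fix z assume "p = Fin z" "q = Infty"
    then show "p = q" using eq stereo_snd_less_1[of z] by simp
  next
    fix w assume "p = Infty" "q = Fin w"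
    then show "p = q" using eq stereo_snd_less_1[of w] by (metis less_irrefl snd_conv stereo.simps(2))
  qed simp
qed

text \<open>The sphere carries the chordal metric. It induces the usual topology and is
  bi-Lipschitz equivalent to the geodesic spherical metric.\<close>

instantiation riemann_sphere :: metric_space
begin

definition dist_riemann_sphere :: "riemann_sphere \<Rightarrow> riemann_sphere \<Rightarrow> real" where
  "dist_riemann_sphere p q = dist (stereo p) (stereo q)"

definition uniformity_riemann_sphere :: "(riemann_sphere \<times> riemann_sphere) filter" where
  "uniformity_riemann_sphere = (INF e\<in>{0<..}. principal {(x, y). dist x y < e})"

definition open_riemann_sphere :: "riemann_sphere set \<Rightarrow> bool" where
  "open_riemann_sphere U \<longleftrightarrow> (\<forall>x\<in>U. eventually (\<lambda>(x', y). x' = x \<longrightarrow> y \<in> U) uniformity)"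

instance
proof
  fix x y z :: riemann_sphere
  show "dist x y = 0 \<longleftrightarrow> x = y"
    by (simp add: dist_riemann_sphere_def inj_eq[OF inj_stereo])
  show "dist x y \<le> dist x z + dist y z"
    by (simp add: dist_riemann_sphere_def dist_triangle2)
qed (simp_all only: uniformity_riemann_sphere_def open_riemann_sphere_def)

end

lemma continuous_on_Fin: "continuous_on UNIV Fin"
proof -
  have nz: "1 + (cmod z)\<^sup>2 \<noteq> 0" "(cmod z)\<^sup>2 + 1 \<noteq> 0" for z
    using zero_le_power2[of "cmod z"] by linarith+
  have "continuous_on UNIV (\<lambda>z. stereo (Fin z))"
    by (auto intro!: continuous_intros simp: nz)
  then show ?thesis
    by (simp add: continuous_on_iff dist_riemann_sphere_def)
qed

text \<open>Two-dimensional Lebesgue (area) measure of the sphere, in the coordinate \<open>z\<close>;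
  the point at infinity is a null set.\<close>

definition sphere_measure :: "riemann_sphere measure" where
  "sphere_measure =
     distr (density lborel (\<lambda>z. ennreal (4 / (1 + (cmod z)\<^sup>2)\<^sup>2))) borel Fin"


section \<open>Rational maps\<close>

text \<open>The map \<open>P/Q\<close>, meaningful for coprime \<open>P\<close>, \<open>Q\<close>. At infinity it is given by the
  coefficients of degree \<open>max (deg P) (deg Q)\<close>.\<close>

fun ratio_map :: "complex poly \<Rightarrow> complex poly \<Rightarrow> riemann_sphere \<Rightarrow> riemann_sphere" where
  "ratio_map P Q (Fin z) = (if poly Q z = 0 then Infty else Fin (poly P z / poly Q z))"
| "ratio_map P Q Infty =
     (let d = max (degree P) (degree Q)
      in if coeff Q d = 0 then Infty else Fin (coeff P d / coeff Q d))"

definition rational_map :: "(riemann_sphere \<Rightarrow> riemann_sphere) \<Rightarrow> bool" where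
  "rational_map f \<longleftrightarrow> (\<exists>P Q. coprime P Q \<and> f = ratio_map P Q)"

definition moebius :: "(riemann_sphere \<Rightarrow> riemann_sphere) \<Rightarrow> bool" where
  "moebius f \<longleftrightarrow> (\<exists>a b c d. a * d - b * c \<noteq> 0 \<and> f = ratio_map [:b, a:] [:d, c:])"

text \<open>Elliptic: conjugate by a Moebius transformation to a nontrivial rotation
  \<open>z \<mapsto> c z\<close>.\<close>

definition elliptic :: "(riemann_sphere \<Rightarrow> riemann_sphere) \<Rightarrow> bool" where
  "elliptic f \<longleftrightarrow> moebius f \<and>
     (\<exists>\<phi> c. moebius \<phi> \<and> cmod c = 1 \<and> c \<noteq> 1 \<and> \<phi> \<circ> f = ratio_map [:0, c:] 1 \<circ> \<phi>)"


section \<open>Derivative and multiplicity\<close>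

text \<open>Holomorphic coordinates around a base point: \<open>z\<close> if it is finite, \<open>1/z\<close> if it is infinite.
  The base point itself has coordinate \<open>chart p p\<close>; values outside the coordinate domain are
  immaterial.\<close>

fun chart :: "riemann_sphere \<Rightarrow> riemann_sphere \<Rightarrow> complex" where
  "chart (Fin a) q = (case q of Fin z \<Rightarrow> z | Infty \<Rightarrow> 0)"
| "chart Infty q = (case q of Fin z \<Rightarrow> inverse z | Infty \<Rightarrow> 0)"

fun chart_inv :: "riemann_sphere \<Rightarrow> complex \<Rightarrow> riemann_sphere" where
  "chart_inv (Fin a) w = Fin w"
| "chart_inv Infty w = (if w = 0 then Infty else Fin (inverse w))"

definition local_rep ::
    "(riemann_sphere \<Rightarrow> riemann_sphere) \<Rightarrow> riemann_sphere \<Rightarrow> complex \<Rightarrow> complex" where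
  "local_rep f p w = chart (f p) (f (chart_inv p w))"

text \<open>The spherical metric is \<open>2 |dw| / (1 + |w|\<^sup>2)\<close> in both coordinates.\<close>

definition spherical_deriv :: "(riemann_sphere \<Rightarrow> riemann_sphere) \<Rightarrow> riemann_sphere \<Rightarrow> real" where
  "spherical_deriv f p =
     cmod (deriv (local_rep f p) (chart p p))
       * (1 + (cmod (chart p p))\<^sup>2) / (1 + (cmod (chart (f p) (f p)))\<^sup>2)"

definition multiplicity_at :: "(riemann_sphere \<Rightarrow> riemann_sphere) \<Rightarrow> riemann_sphere \<Rightarrow> nat" where
  "multiplicity_at f p =
     nat (zorder (\<lambda>w. local_rep f p w - local_rep f p (chart p p)) (chart p p))"


section \<open>Rational semigroups, Fatou and Julia sets\<close>

definition rational_semigroup :: "(riemann_sphere \<Rightarrow> riemann_sphere) set \<Rightarrow> bool" where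
  "rational_semigroup G \<longleftrightarrow> G \<noteq> {} \<and>
     (\<forall>g\<in>G. rational_map g \<and> \<not> g constant_on UNIV) \<and> (\<forall>f\<in>G. \<forall>g\<in>G. f \<circ> g \<in> G)"

inductive_set generated_semigroup :: "('a \<Rightarrow> 'a) set \<Rightarrow> ('a \<Rightarrow> 'a) set"
  for H :: "('a \<Rightarrow> 'a) set" where
  generator: "h \<in> H \<Longrightarrow> h \<in> generated_semigroup H"
| compose: "f \<in> generated_semigroup H \<Longrightarrow> g \<in> generated_semigroup H \<Longrightarrow>
    f \<circ> g \<in> generated_semigroup H"

definition normal_on :: "riemann_sphere set \<Rightarrow> (riemann_sphere \<Rightarrow> riemann_sphere) set \<Rightarrow> bool" where
  "normal_on W G \<longleftrightarrow>
     (\<forall>f :: nat \<Rightarrow> riemann_sphere \<Rightarrow> riemann_sphere. range f \<subseteq> G \<longrightarrow>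
        (\<exists>r l. strict_mono r \<and>
           (\<forall>K. compact K \<and> K \<subseteq> W \<longrightarrow> uniform_limit K (\<lambda>n. f (r n)) l sequentially)))"

definition Fatou :: "(riemann_sphere \<Rightarrow> riemann_sphere) set \<Rightarrow> riemann_sphere set" where
  "Fatou G = {z. \<exists>W. open W \<and> z \<in> W \<and> normal_on W G}"

definition Julia :: "(riemann_sphere \<Rightarrow> riemann_sphere) set \<Rightarrow> riemann_sphere set" where
  "Julia G = - Fatou G"

definition open_set_condition ::
    "nat \<Rightarrow> (nat \<Rightarrow> riemann_sphere \<Rightarrow> riemann_sphere) \<Rightarrow> riemann_sphere set \<Rightarrow> bool" where
  "open_set_condition m h U \<longleftrightarrow> open U \<and> U \<noteq> {} \<and>
     (\<forall>j\<in>{1..m}. h j -` U \<subseteq> U) \<and> disjoint_family_on (\<lambda>j. h j -` U) {1..m}"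


section \<open>Poincare series\<close>

text \<open>Extended power \<open>t\<^sup>a\<close> of a real \<open>t \<ge> 0\<close>, with \<open>0\<^sup>a = \<infinity>\<close> for \<open>a < 0\<close>
  and \<open>0\<^sup>0 = 1\<close>; note that \<open>0 powr a = 0\<close> for every \<open>a\<close>.\<close>

definition epowr :: "real \<Rightarrow> real \<Rightarrow> ennreal" where
  "epowr t a = (if t = 0 then (if a < 0 then \<infinity> else if a = 0 then 1 else 0)
                else ennreal (t powr a))"

definition poincare_series ::
    "(riemann_sphere \<Rightarrow> riemann_sphere) set \<Rightarrow> real \<Rightarrow> riemann_sphere \<Rightarrow> ennreal" where
  "poincare_series G s x =
     (\<Sum>\<^sub>\<infinity>g\<in>G. \<Sum>\<^sub>\<infinity>y\<in>g -` {x}. of_nat (multiplicity_at g y) * epowr (spherical_deriv g y) (- s))"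

definition critical_exponent_at ::
    "(riemann_sphere \<Rightarrow> riemann_sphere) set \<Rightarrow> riemann_sphere \<Rightarrow> ereal" where
  "critical_exponent_at G x = Inf (ereal ` {s. poincare_series G s x < \<infinity>})"

definition s\<^sub>0 :: "(riemann_sphere \<Rightarrow> riemann_sphere) set \<Rightarrow> ereal" where
  "s\<^sub>0 G = (INF x. critical_exponent_at G x)"

end

theory Submission
  imports Defs
begin

text \<open>
  The sum of \<open>\<parallel>g'(y)\<parallel>\<^sup>-\<^sup>2\<close> over the fibre \<open>g y = x\<close> is the density of the push-forward of spherical
  area under \<open>g\<close>. Its integral over \<open>V\<close> is therefore the area of \<open>g -` V\<close>, and \<open>S(2,x)\<close> is finite
  almost everywhere on \<open>V\<close> as soon as the sets \<open>g -` V\<close>, \<open>g \<in> G\<close>, are disjoint. By the open set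
  condition, this holds when \<open>V \<subseteq> U\<close> is wandering: \<open>g ` V \<inter> V = {}\<close> for all \<open>g \<in> G\<close>.

  A family of rational maps omitting an open set is normal. Hence \<open>J(G)\<close> lies in the closure of \<open>U\<close>,
  the open set \<open>\<Omega> = U \<inter> F(G)\<close> is non-empty, and \<open>h\<^sub>j -` \<Omega> \<subseteq> \<Omega>\<close>. If \<open>\<Omega>\<close> contained no wandering open
  set, every point of \<open>\<Omega>\<close> would be recurrent by equicontinuity. Recurrence at two points \<open>y\<^sub>1\<close>, \<open>y\<^sub>2\<close>
  with \<open>h\<^sub>i y\<^sub>1 = h\<^sub>j y\<^sub>2 \<in> \<Omega>\<close> forces \<open>y\<^sub>1 = y\<^sub>2\<close>, so that points of \<open>\<Omega>\<close> have a single preimage under all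
  generators together. Then there is only one generator, it has degree one, and a Moebius
  transformation that is recurrent on an open set is the identity or elliptic.
\<close>

section \<open>The Riemann sphere and its rational maps\<close>

text \<open>Finiteness almost everywhere needs only an upper bound on the integral of the fibre
  sums, so the change of variables is carried out up to a constant, by a Lipschitz estimate on small
  balls. The constant must not depend on \<open>g\<close>, because the bounds are added over all of
  \<open>G\<close>. The obstacle in the recurrent case is that points return only approximately. The
  open set condition determines a word only at a point that the word sends into \<open>U\<close>;
  near-returns therefore have to land in a ball inside \<open>U\<close>, and equicontinuity gives a
  margin valid for all words at once. This is available on the Fatou set, whence the work inside
  \<open>\<Omega>\<close>. Single preimages over the open set \<open>\<Omega>\<close> still
  determine the degree, since a map of degree at least two has several preimages of all but finitely
  many points.\<close>

definition proj :: "complex \<Rightarrow> complex \<Rightarrow> riemann_sphere" where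
  "proj z w = (if w = 0 then Infty else Fin (z / w))"

definition recip :: "riemann_sphere \<Rightarrow> riemann_sphere" where
  "recip p = (case p of Fin z \<Rightarrow> proj 1 z | Infty \<Rightarrow> Fin 0)"

definition finite_part :: "riemann_sphere \<Rightarrow> complex" where
  "finite_part p = (case p of Fin z \<Rightarrow> z | Infty \<Rightarrow> 0)"

lemma finite_part_Fin [simp]: "finite_part (Fin z) = z"
  by (simp add: finite_part_def)

lemma recip_recip [simp]: "recip (recip p) = p"
  by (cases p) (auto simp: recip_def proj_def)

lemma recip_Infty [simp]: "recip Infty = Fin 0"
  by (simp add: recip_def)

lemma proj_scale: "k \<noteq> 0 \<Longrightarrow> proj (k * z) (k * w) = proj z w"
  by (simp add: proj_def)

lemma proj_eq_iff:
  assumes "z \<noteq> 0 \<or> w \<noteq> 0" "z' \<noteq> 0 \<or> w' \<noteq> 0"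
  shows "proj z w = proj z' w' \<longleftrightarrow> z * w' = z' * w"
  using assms by (auto simp: proj_def field_simps)

text \<open>Inversion is the half turn of the unit sphere about the real axis, hence an isometry of
  the chordal metric. This reduces questions at \<open>Infty\<close> to questions at
  \<open>Fin 0\<close>.\<close>

lemma stereo_recip: "stereo (recip p) = (cnj (fst (stereo p)), - snd (stereo p))"
proof (cases p)
  case (Fin z)
  show ?thesis
  proof (cases "z = 0")
    case False
    define n where "n = (cmod z)\<^sup>2"
    have n: "n > 0" using False by (simp add: n_def)
    have i: "1 / z = cnj z / of_real n"
      using False by (simp add: n_def complex_div_cnj[of 1 z])
    have m: "(cmod (1 / z))\<^sup>2 = 1 / n" by (simp add: n_def norm_divide power_divide)
    have "stereo (recip p) = ((2 / (1 + 1 / n)) *\<^sub>R (cnj z / of_real n), (1 / n - 1) / (1 / n + 1))"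
      using Fin False m i by (simp add: recip_def proj_def)
    also have "(2 / (1 + 1 / n)) *\<^sub>R (cnj z / of_real n) = (2 / (1 + n)) *\<^sub>R cnj z"
    proof -
      have "(2 / (1 + 1 / n)) / n = 2 / ((1 + 1 / n) * n)" by simp
      also have "(1 + 1 / n) * n = 1 + n" using n by (simp add: distrib_right)
      finally have "(2 / (1 + 1 / n)) / n = 2 / (1 + n)" .
      moreover have "cnj z / of_real n = (1 / n) *\<^sub>R cnj z" by (simp add: scaleR_conv_of_real)
      ultimately show ?thesis by (metis scaleR_scaleR times_divide_eq_right mult.right_neutral)
    qed
    also have "(1 / n - 1) / (1 / n + 1) = - ((n - 1) / (n + 1))"
    proof -
      have "1 / n - 1 = (1 - n) / n" "1 / n + 1 = (1 + n) / n"
        using n by (simp_all add: diff_divide_distrib add_divide_distrib)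
      then have "(1 / n - 1) / (1 / n + 1) = (1 - n) / (1 + n)" using n by simp
      also have "\<dots> = - ((n - 1) / (n + 1))" by (metis add.commute minus_diff_eq minus_divide_left)
      finally show ?thesis .
    qed
    finally show ?thesis using Fin by (simp add: n_def)
  qed (use Fin in \<open>simp add: recip_def proj_def\<close>)
qed simp

lemma dist_recip: "dist (recip p) (recip q) = dist p q"
proof -
  have *: "cnj a - cnj b = cnj (a - b)" "- s - - t = - (s - t)" for a b :: complex and s t :: real by simp_all
  show ?thesis
    unfolding dist_riemann_sphere_def stereo_recip dist_prod_def dist_norm fst_conv snd_conv *
    by (simp only: complex_mod_cnj norm_minus_cancel)
qed

lemma continuous_on_recip: "continuous_on S recip"
  by (auto simp: continuous_on_iff dist_recip)

lemma isCont_recip: "isCont recip p"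
  using continuous_on_recip[of UNIV] by (simp add: continuous_on_eq_continuous_at)

lemma isCont_Fin: "isCont Fin z"
  using continuous_on_Fin by (simp add: continuous_on_eq_continuous_at)

text \<open>Where \<open>g\<close> vanishes the quotient \<open>f / g\<close> is of no use, but
  inversion exchanges the homogeneous coordinates and leaves the finite quotient
  \<open>g / f\<close>.\<close>

lemma isCont_proj:
  assumes "isCont f x" "isCont g x" "f x \<noteq> 0 \<or> g x \<noteq> 0"
  shows "isCont (\<lambda>x. proj (f x) (g x)) x"
proof (cases "g x = 0")
  case False
  have "\<forall>\<^sub>F y in nhds x. g y \<noteq> 0"
    using assms(2) False by (simp add: isCont_def tendsto_imp_eventually_ne eventually_nhds_conv_at)
  then have ev: "\<forall>\<^sub>F y in nhds x. proj (f y) (g y) = Fin (f y / g y)"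
    by eventually_elim (simp add: proj_def)
  have "isCont (\<lambda>y. Fin (f y / g y)) x"
    by (rule isCont_o2[OF _ isCont_Fin]) (use assms False in \<open>auto intro!: continuous_intros\<close>)
  then show ?thesis using isCont_cong[OF ev] by blast
next
  case True
  then have nz: "f x \<noteq> 0" using assms by auto
  have "\<forall>\<^sub>F y in nhds x. f y \<noteq> 0"
    using assms(1) nz by (simp add: isCont_def tendsto_imp_eventually_ne eventually_nhds_conv_at)
  then have ev: "\<forall>\<^sub>F y in nhds x. proj (f y) (g y) = recip (Fin (g y / f y))"
    by eventually_elim (auto simp: proj_def recip_def)
  have "isCont (\<lambda>y. recip (Fin (g y / f y))) x"
    by (rule isCont_o2[OF isCont_o2[OF _ isCont_Fin] isCont_recip])
       (use assms nz in \<open>auto intro!: continuous_intros\<close>)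
  then show ?thesis using isCont_cong[OF ev] by blast
qed

text \<open>This is projection from the pole back to the plane; it shows that the affine coordinate
  depends continuously on the point.\<close>

lemma finite_part_stereo:
  assumes "p \<noteq> Infty"
  shows "finite_part p = fst (stereo p) / of_real (1 - snd (stereo p))"
proof -
  obtain z where p: "p = Fin z" using assms by (cases p) auto
  define n where "n = 1 + (cmod z)\<^sup>2"
  have n: "n > 0" by (simp add: n_def add_pos_nonneg)
  have "1 - (n - 2) / n = 2 / n" using n by (simp add: field_simps)
  then have "1 - snd (stereo p) = 2 / n" by (simp add: p n_def add.commute)
  moreover have "fst (stereo p) = of_real (2 / n) * z" by (simp add: p n_def scaleR_conv_of_real)
  moreover have "complex_of_real (2 / n) \<noteq> 0" using n by simp
  ultimately show ?thesis using p by (simp only: finite_part_Fin nonzero_mult_div_cancel_left simp_thms)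
qed

lemma continuous_on_stereo: "continuous_on S stereo"
  by (auto simp: continuous_on_iff dist_riemann_sphere_def)

lemma continuous_on_finite_part: "continuous_on (- {Infty}) finite_part"
proof -
  have nz: "1 - snd (stereo p) \<noteq> 0" if "p \<in> - {Infty}" for p
    using that stereo_snd_less_1 by (cases p) (auto simp del: stereo.simps simp: less_le)
  have "continuous_on (- {Infty}) (\<lambda>p. fst (stereo p) / of_real (1 - snd (stereo p)))"
    using nz by (intro continuous_intros continuous_on_stereo) (auto simp: of_real_eq_0_iff simp del: of_real_diff)
  then show ?thesis
    by (rule continuous_on_cong[THEN iffD1, rotated 2]) (auto simp: finite_part_stereo)
qed

lemma open_Compl_Infty: "open (- {Infty :: riemann_sphere})"
  by auto

lemma open_Fin_image:
  assumes "open S"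
  shows "open (Fin ` S)"
proof -
  have "Fin ` S = finite_part -` S \<inter> - {Infty}"
  proof (intro set_eqI iffI)
    fix p assume "p \<in> finite_part -` S \<inter> - {Infty}"
    then show "p \<in> Fin ` S" by (cases p) auto
  qed auto
  moreover have "open (finite_part -` S \<inter> - {Infty})"
    by (intro continuous_on_open_vimage[THEN iffD1, rule_format] continuous_on_finite_part assms open_Compl_Infty)
  ultimately show ?thesis by simp
qed

lemma recip_image: "recip ` S = recip -` S"
proof (intro set_eqI iffI)
  fix p assume "p \<in> recip -` S"
  then have "recip (recip p) \<in> recip ` S" by blast
  then show "p \<in> recip ` S" by simp
qed auto

lemma open_recip_image: "open S \<Longrightarrow> open (recip ` S)"
  unfolding recip_image by (rule open_vimage[OF _ continuous_on_recip])

lemma compact_UNIV_riemann_sphere: "compact (UNIV :: riemann_sphere set)"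
proof -
  have "p \<in> Fin ` cball 0 1 \<union> recip ` Fin ` cball 0 1" for p
  proof (cases p)
    case (Fin z)
    show ?thesis
    proof (cases "cmod z \<le> 1")
      case False
      then have z: "z \<noteq> 0" "cmod (1 / z) \<le> 1" by (auto simp: norm_divide divide_le_eq)
      then have "p = recip (Fin (1 / z))" by (simp add: Fin recip_def proj_def)
      then show ?thesis using z by auto
    qed (use Fin in auto)
  next
    case Infty
    then have "p = recip (Fin 0)" by (simp add: recip_def proj_def)
    then show ?thesis by auto
  qed
  then have "UNIV = Fin ` cball 0 1 \<union> recip ` Fin ` cball 0 1" by blast
  then show ?thesis
    by (metis compact_Un compact_cball compact_continuous_image continuous_on_Fin
        continuous_on_recip continuous_on_subset subset_UNIV)
qed

lemma open_vimage_Fin: "open S \<Longrightarrow> open (Fin -` S)"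
  by (rule open_vimage[OF _ continuous_on_Fin])

text \<open>The only case with content is \<open>Infty\<close>, which is not isolated: it is the
  limit of \<open>proj 1 w\<close> as \<open>w\<close> tends to zero.\<close>

lemma vimage_Fin_nonempty:
  assumes "open S" "S \<noteq> {}"
  shows "Fin -` S \<noteq> {}"
proof -
  obtain p where p: "p \<in> S" using assms by auto
  show ?thesis
  proof (cases p)
    case Infty
    have "isCont (\<lambda>w. proj 1 w) 0" by (intro isCont_proj) auto
    moreover have "proj 1 0 \<in> S" using p Infty by (simp add: proj_def)
    ultimately have "\<forall>\<^sub>F w in at 0. proj 1 w \<in> S"
      using assms(1) by (simp add: isCont_def tendsto_def)
    moreover have "\<forall>\<^sub>F w::complex in at 0. w \<noteq> 0" by (simp add: eventually_at_filter)
    ultimately have "\<forall>\<^sub>F w in at 0. proj 1 w \<in> S \<and> w \<noteq> 0" by (rule eventually_conj)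
    then have "\<exists>w. proj 1 w \<in> S \<and> w \<noteq> 0" by (rule eventually_happens'[OF at_neq_bot])
    then show ?thesis by (auto simp: proj_def)
  qed (use p in auto)
qed

text \<open>The condition on common zeros excludes the indeterminate value \<open>proj 0 0\<close>.\<close>

definition poly_rep :: "(riemann_sphere \<Rightarrow> riemann_sphere) \<Rightarrow> complex poly \<Rightarrow> complex poly \<Rightarrow> bool" where
  "poly_rep f P Q \<longleftrightarrow> (\<forall>z. f (Fin z) = proj (poly P z) (poly Q z) \<and> (poly P z \<noteq> 0 \<or> poly Q z \<noteq> 0))"

lemma coprime_poly_nonzero:
  assumes "coprime P (Q :: complex poly)"
  shows "poly P z \<noteq> 0 \<or> poly Q z \<noteq> 0"
proof (rule ccontr)
  assume "\<not> ?thesis"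
  then have "[:- z, 1:] dvd P" "[:- z, 1:] dvd Q" by (auto simp: poly_eq_0_iff_dvd)
  then have "is_unit [:- z, 1:]" using assms coprime_common_divisor by blast
  then show False by (simp add: is_unit_iff_degree)
qed

lemma poly_rep_ratio_map:
  assumes "coprime P Q"
  shows "poly_rep (ratio_map P Q) P Q"
  using coprime_poly_nonzero[OF assms] by (auto simp: poly_rep_def proj_def)

text \<open>The coefficients in degree \<open>d\<close> are the homogeneous coordinates of the value
  at \<open>Infty\<close>, so this is the counterpart at \<open>Infty\<close> of
  \<open>coprime_poly_nonzero\<close>.\<close>

lemma coprime_leading:
  assumes "coprime P (Q :: complex poly)" "d = max (degree P) (degree Q)"
  shows "coeff P d \<noteq> 0 \<or> coeff Q d \<noteq> 0"
proof (rule ccontr)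
  assume *: "\<not> ?thesis"
  then have "lead_coeff P = 0 \<or> lead_coeff Q = 0" using assms(2) by (auto simp: max_def split: if_splits)
  then have "P = 0 \<and> Q = 0" using * assms(2) by auto
  then show False using assms(1) by auto
qed

lemma poly_rep_ratio_map_recip:
  assumes "coprime P Q"
  shows "\<exists>P' Q'. poly_rep (ratio_map P Q \<circ> recip) P' Q'"
proof -
  define d where "d = max (degree P) (degree Q)"
  \<comment> \<open>The reversal \<open>w ^ d * poly R (1 / w)\<close> is taken with respect to the
    common degree \<open>d\<close>; the monomial makes up for a smaller degree of
    \<open>R\<close>.\<close>
  define rev where "rev R = monom 1 (d - degree R) * reflect_poly R" for R :: "complex poly"
  have rev0: "poly (rev R) 0 = coeff R d" if "degree R \<le> d" for R
  proof (cases "degree R = d")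
    case False
    then have "coeff R d = 0" using that by (simp add: coeff_eq_0)
    then show ?thesis using False that by (simp add: rev_def poly_monom)
  qed (simp add: rev_def)
  have rev: "poly (rev R) w = w ^ d * poly R (1 / w)" if "degree R \<le> d" "w \<noteq> 0" for R w
  proof -
    have "w ^ (d - degree R) * w ^ degree R = w ^ d" using that by (simp flip: power_add)
    then show ?thesis using that by (simp add: rev_def poly_monom poly_reflect_poly_nz inverse_eq_divide mult.assoc[symmetric])
  qed
  have d: "degree P \<le> d" "degree Q \<le> d" by (auto simp: d_def)
  have "poly_rep (ratio_map P Q \<circ> recip) (rev P) (rev Q)"
    unfolding poly_rep_def
  proof (intro allI conjI)
    fix z
    show "(ratio_map P Q \<circ> recip) (Fin z) = proj (poly (rev P) z) (poly (rev Q) z)"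
      by (cases "z = 0")
         (simp_all add: recip_def rev rev0 d proj_def Let_def flip: d_def)
    show "poly (rev P) z \<noteq> 0 \<or> poly (rev Q) z \<noteq> 0"
      by (cases "z = 0")
         (use coprime_leading[OF assms d_def] coprime_poly_nonzero[OF assms] in \<open>auto simp: rev rev0 d\<close>)
  qed
  then show ?thesis by blast
qed

lemma rational_map_poly_rep:
  assumes "rational_map f"
  shows "\<exists>P Q. poly_rep f P Q" "\<exists>P Q. poly_rep (f \<circ> recip) P Q"
  using assms poly_rep_ratio_map poly_rep_ratio_map_recip unfolding rational_map_def by blast+

lemma isCont_poly_rep_Fin:
  assumes "poly_rep f P Q"
  shows "isCont f (Fin z)"
proof -
  have "isCont (\<lambda>w. f (Fin w)) z"
    using assms by (auto simp: poly_rep_def intro!: isCont_proj poly_isCont)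
  moreover have "isCont finite_part (Fin z)"
    by (rule continuous_on_interior[OF continuous_on_finite_part]) (unfold interior_open[OF open_Compl_Infty], simp)
  ultimately have "isCont (\<lambda>p. f (Fin (finite_part p))) (Fin z)"
    using isCont_o2[of "Fin z" finite_part "\<lambda>w. f (Fin w)"] by simp
  moreover have "\<forall>\<^sub>F p in nhds (Fin z). p \<in> - {Infty}"
    by (rule eventually_nhds_in_open) auto
  then have "\<forall>\<^sub>F p in nhds (Fin z). f (Fin (finite_part p)) = f p"
  proof eventually_elim
    case (elim p)
    then show ?case by (cases p) auto
  qed
  ultimately show ?thesis using isCont_cong by force
qed

lemma rational_map_isCont:
  assumes "rational_map f"
  shows "isCont f p"
proof (cases p)
  case (Fin z)
  then show ?thesis using rational_map_poly_rep(1)[OF assms] isCont_poly_rep_Fin by blast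
next
  case Infty
  have "isCont (f \<circ> recip) (recip Infty)"
    using rational_map_poly_rep(2)[OF assms] isCont_poly_rep_Fin by (metis recip_Infty)
  then have "isCont (\<lambda>p. (f \<circ> recip) (recip p)) Infty"
    by (intro isCont_o2[OF isCont_recip]) 
  then show ?thesis by (simp add: Infty)
qed

lemma rational_map_continuous_on: "rational_map f \<Longrightarrow> continuous_on S f"
  by (simp add: continuous_at_imp_continuous_on rational_map_isCont)

lemma ratio_map_degree_pos:
  assumes "\<not> ratio_map P Q constant_on UNIV"
  shows "max (degree P) (degree Q) > 0"
proof (rule ccontr)
  assume "\<not> ?thesis"
  then have "degree P = 0" "degree Q = 0" by auto
  then obtain p q where "P = [:p:]" "Q = [:q:]" by (metis degree_eq_zeroE)
  then have "ratio_map P Q y = proj p q" for y by (cases y) (auto simp: proj_def)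
  then show False using assms by (auto simp: constant_on_def)
qed

text \<open>A finite preimage of \<open>proj a b\<close> is a root of \<open>b P - a Q\<close>. If
  there is no root, this polynomial is constant, its coefficient in degree \<open>d > 0\<close>
  vanishes, and that makes \<open>Infty\<close> a preimage.\<close>

lemma rational_map_surj:
  assumes "rational_map f" "\<not> f constant_on UNIV"
  shows "surj f"
proof -
  obtain P Q where PQ: "coprime P Q" "f = ratio_map P Q" using assms by (auto simp: rational_map_def)
  have rep: "f (Fin z) = proj (poly P z) (poly Q z)" for z using PQ by (simp add: proj_def)
  define d where "d = max (degree P) (degree Q)"
  have fInf: "f Infty = proj (coeff P d) (coeff Q d)" using PQ by (simp add: d_def proj_def Let_def)
  have d: "d > 0" using ratio_map_degree_pos[of P Q] assms(2) PQ by (simp add: d_def)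
  have hit: "\<exists>y. f y = proj a b" if ab: "a \<noteq> 0 \<or> b \<noteq> 0" for a b
  proof -
    define R where "R = smult b P - smult a Q"
    show ?thesis
    proof (cases "\<exists>z. poly R z = 0")
      case True
      then obtain z where "b * poly P z = a * poly Q z" by (auto simp: R_def)
      then have "proj (poly P z) (poly Q z) = proj a b"
        using ab coprime_poly_nonzero[OF PQ(1)] by (subst proj_eq_iff) (auto simp: mult.commute)
      then show ?thesis using rep by metis
    next
      case False
      then have "degree R = 0"
        using fundamental_theorem_of_algebra constant_degree by metis
      then have "coeff R d = 0" using d by (simp add: coeff_eq_0)
      then have "proj (coeff P d) (coeff Q d) = proj a b"
        using ab coprime_leading[OF PQ(1) d_def] by (subst proj_eq_iff) (auto simp: R_def mult.commute)
      then show ?thesis using fInf by metis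
    qed
  qed
  have "\<exists>a b. (a \<noteq> 0 \<or> b \<noteq> 0) \<and> proj a b = p" for p
  proof (cases p)
    case (Fin z)
    then show ?thesis by (intro exI[of _ z] exI[of _ 1]) (simp add: proj_def)
  next
    case Infty
    then show ?thesis by (intro exI[of _ 1] exI[of _ 0]) (simp add: proj_def)
  qed
  then have "p \<in> range f" for p using hit by (metis rangeI)
  then show ?thesis by blast
qed

section \<open>Normality of families omitting an open set\<close>

lemma normal_on_subset: "normal_on W F \<Longrightarrow> W' \<subseteq> W \<Longrightarrow> normal_on W' F"
  unfolding normal_on_def by (meson order_trans)

lemma normal_on_mono: "normal_on W F \<Longrightarrow> F' \<subseteq> F \<Longrightarrow> normal_on W F'"
  unfolding normal_on_def by (meson order_trans)

lemma normal_on_subseq: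
  assumes "normal_on W F" "strict_mono (r :: nat \<Rightarrow> nat)" "\<And>n. f (r n) \<in> F"
  shows "\<exists>r l. strict_mono r \<and> (\<forall>K. compact K \<and> K \<subseteq> W \<longrightarrow> uniform_limit K (\<lambda>n. f (r n)) l sequentially)"
proof -
  have "range (\<lambda>n. f (r n)) \<subseteq> F" using assms(3) by auto
  then obtain r' l where "strict_mono r'"
    "\<And>K. compact K \<and> K \<subseteq> W \<Longrightarrow> uniform_limit K (\<lambda>n. f (r (r' n))) l sequentially"
    using assms(1)[unfolded normal_on_def, rule_format, of "\<lambda>n. f (r n)"] by blast
  then show ?thesis
    by (intro exI[of _ "r \<circ> r'"] exI[of _ l]) (auto intro: strict_mono_o assms(2))
qed

text \<open>Any sequence in the union visits one of the two families infinitely often.\<close>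

lemma normal_on_Un:
  assumes "normal_on W A" "normal_on W B"
  shows "normal_on W (A \<union> B)"
  unfolding normal_on_def
proof (intro allI impI)
  fix f :: "nat \<Rightarrow> riemann_sphere \<Rightarrow> riemann_sphere" assume f: "range f \<subseteq> A \<union> B"
  have "infinite {n. f n \<in> A} \<or> infinite {n. f n \<in> B}"
  proof (rule ccontr)
    assume "\<not> ?thesis"
    then have "finite ({n. f n \<in> A} \<union> {n. f n \<in> B})" by blast
    moreover have "{n. f n \<in> A} \<union> {n. f n \<in> B} = UNIV" using f by blast
    ultimately show False by simp
  qed
  then obtain C where C: "infinite {n. f n \<in> C}" "normal_on W C" using assms by blast
  obtain r :: "nat \<Rightarrow> nat" where "strict_mono r" "\<And>n. r n \<in> {n. f n \<in> C}"
    using infinite_enumerate[OF C(1)] by blast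
  then show "\<exists>r l. strict_mono r \<and> (\<forall>K. compact K \<and> K \<subseteq> W \<longrightarrow> uniform_limit K (\<lambda>n. f (r n)) l sequentially)"
    using normal_on_subseq[OF C(2)] by blast
qed

lemma normal_on_singleton: "normal_on W {f}"
  unfolding normal_on_def
proof (intro allI impI)
  fix g :: "nat \<Rightarrow> riemann_sphere \<Rightarrow> riemann_sphere" assume "range g \<subseteq> {f}"
  then have "g n = f" for n by auto
  then show "\<exists>r l. strict_mono r \<and> (\<forall>K. compact K \<and> K \<subseteq> W \<longrightarrow> uniform_limit K (\<lambda>n. g (r n)) l sequentially)"
    by (intro exI[of _ id] exI[of _ f]) (auto simp: strict_mono_def uniform_limit_iff)
qed

lemma normal_on_compose:
  assumes "normal_on W F" "continuous_on W' h" "h ` W' \<subseteq> W"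
  shows "normal_on W' ((\<lambda>f. f \<circ> h) ` F)"
  unfolding normal_on_def
proof (intro allI impI)
  fix f :: "nat \<Rightarrow> riemann_sphere \<Rightarrow> riemann_sphere" assume "range f \<subseteq> (\<lambda>f. f \<circ> h) ` F"
  then have "\<forall>n. \<exists>g. g \<in> F \<and> f n = g \<circ> h" by auto
  then obtain g where g: "\<And>n. g n \<in> F" "\<And>n. f n = g n \<circ> h" by metis
  then obtain r l where r: "strict_mono r"
    and l: "\<And>K. compact K \<and> K \<subseteq> W \<Longrightarrow> uniform_limit K (\<lambda>n. g (r n)) l sequentially"
    using assms(1)[unfolded normal_on_def, rule_format, of g] by blast
  have "uniform_limit K (\<lambda>n. f (r n)) (l \<circ> h) sequentially" if "compact K" "K \<subseteq> W'" for K
  proof -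
    have "compact (h ` K)" "h ` K \<subseteq> W"
      using that assms compact_continuous_image continuous_on_subset by blast+
    then show ?thesis using l[of "h ` K"] by (auto simp: uniform_limit_iff g(2))
  qed
  then show "\<exists>r l. strict_mono r \<and> (\<forall>K. compact K \<and> K \<subseteq> W' \<longrightarrow> uniform_limit K (\<lambda>n. f (r n)) l sequentially)"
    using r by blast
qed

text \<open>Counterexamples \<open>f n\<close>, \<open>y n\<close> with \<open>y n\<close> tending
  to \<open>x\<close> would have a subsequence of maps converging uniformly on a closed ball around
  \<open>x\<close>, compact because the sphere is. The limit is continuous there, and three errors
  of \<open>e / 3\<close> give a contradiction.\<close>

lemma normal_on_equicontinuous:
  assumes "normal_on W F" "open W" "x \<in> W" "\<And>f. f \<in> F \<Longrightarrow> continuous_on UNIV f" "e > 0"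
  shows "\<exists>d>0. \<forall>y f. dist y x < d \<longrightarrow> f \<in> F \<longrightarrow> dist (f y) (f x) < e"
proof (rule ccontr)
  assume neg: "\<not> ?thesis"
  have "\<forall>n. \<exists>y f. dist y x < inverse (real (Suc n)) \<and> f \<in> F \<and> \<not> dist (f y) (f x) < e"
  proof
    fix n
    have "inverse (real (Suc n)) > 0" by simp
    then show "\<exists>y f. dist y x < inverse (real (Suc n)) \<and> f \<in> F \<and> \<not> dist (f y) (f x) < e"
      using neg by blast
  qed
  then obtain y f where y: "\<And>n. dist (y n) x < inverse (real (Suc n))" and f: "\<And>n. f n \<in> F"
    and far: "\<And>n. \<not> dist (f n (y n)) (f n x) < e" by metis
  obtain r l where r: "strict_mono r"
    and l: "\<And>K. compact K \<and> K \<subseteq> W \<Longrightarrow> uniform_limit K (\<lambda>n. f (r n)) l sequentially"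
    using assms(1)[unfolded normal_on_def, rule_format, of f] f by blast
  obtain \<delta> where \<delta>: "\<delta> > 0" "cball x \<delta> \<subseteq> W" using assms open_contains_cball by blast
  define K where "K = cball x \<delta>"
  have "compact K" unfolding K_def
    using closed_cball compact_Int_closed[OF compact_UNIV_riemann_sphere] by (metis inf_top_left)
  then have lim: "uniform_limit K (\<lambda>n. f (r n)) l sequentially" using l \<delta> K_def by blast
  have "continuous_on K l"
  proof (rule uniform_limit_theorem[OF _ lim])
    show "\<forall>\<^sub>F n in sequentially. continuous_on K (f (r n))"
      using assms(4) f continuous_on_subset by (intro always_eventually allI) blast
  qed auto
  then obtain d where d: "d > 0" "\<And>z. z \<in> K \<Longrightarrow> dist z x < d \<Longrightarrow> dist (l z) (l x) < e / 3"
    using assms(5) \<delta>(1) K_def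
    by (metis centre_in_cball continuous_on_iff divide_pos_pos less_eq_real_def zero_less_numeral)
  have "y \<longlonglongrightarrow> x"
  proof (rule metric_LIMSEQ_I)
    fix s :: real assume "s > 0"
    then obtain n where "inverse (real (Suc n)) < s" using reals_Archimedean by blast
    moreover have "inverse (real (Suc k)) \<le> inverse (real (Suc n))" if "k \<ge> n" for k
      using that by simp
    ultimately show "\<exists>n. \<forall>k\<ge>n. dist (y k) x < s" using y by (meson less_le_trans less_trans le_less_trans)
  qed
  then have "(\<lambda>n. y (r n)) \<longlonglongrightarrow> x" using LIMSEQ_subseq_LIMSEQ[OF _ r] by (auto simp: o_def)
  then have "\<forall>\<^sub>F n in sequentially. dist (y (r n)) x < min d \<delta>"
    using d(1) \<delta>(1) by (intro tendstoD) auto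
  moreover have "\<forall>\<^sub>F n in sequentially. \<forall>z\<in>K. dist (f (r n) z) (l z) < e / 3"
    using lim[unfolded uniform_limit_iff, rule_format, of "e / 3"] assms(5) by simp
  ultimately have "\<forall>\<^sub>F n in sequentially. False"
  proof eventually_elim
    case (elim n)
    have "y (r n) \<in> K" "x \<in> K" using elim(1) \<delta>(1) by (auto simp: K_def dist_commute)
    then have "dist (f (r n) (y (r n))) (l (y (r n))) < e / 3" "dist (f (r n) x) (l x) < e / 3"
      "dist (l (y (r n))) (l x) < e / 3"
      using elim d(2) by auto
    then have "dist (f (r n) (y (r n))) (f (r n) x) < e"
      using dist_triangle[of "f (r n) (y (r n))" "f (r n) x" "l (y (r n))"]
        dist_triangle2[of "l (y (r n))" "f (r n) x" "l x"] by simp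
    then show ?case using far by blast
  qed
  then show False by simp
qed

text \<open>If \<open>P / Q\<close> stays at distance \<open>\<delta>\<close> from \<open>c\<close>, then \<open>Q / (P - c Q)\<close> is bounded by
  \<open>1 / \<delta>\<close>, so the classical theorem of Montel for bounded families applies.\<close>

lemma normal_near_Fin_if_omits:
  assumes rep: "\<And>f. f \<in> F \<Longrightarrow> \<exists>P Q. poly_rep f P Q"
    and U: "open U" "U \<noteq> {}" and N: "open N" "Fin z\<^sub>0 \<in> N"
    and omit: "\<And>f y. f \<in> F \<Longrightarrow> y \<in> N \<Longrightarrow> f y \<notin> U"
  shows "\<exists>W. open W \<and> Fin z\<^sub>0 \<in> W \<and> normal_on W F"
proof -
  obtain P Q where PQ: "\<And>f. f \<in> F \<Longrightarrow> poly_rep f (P f) (Q f)" using rep by metis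
  obtain c \<delta> where \<delta>: "\<delta> > 0" "ball c \<delta> \<subseteq> Fin -` U"
    using vimage_Fin_nonempty[OF U] open_vimage_Fin[OF U(1)] open_contains_ball by blast
  obtain r where r: "r > 0" "ball z\<^sub>0 r \<subseteq> Fin -` N"
    using open_vimage_Fin[OF N(1)] N(2) open_contains_ball by blast
  define B where "B = ball z\<^sub>0 r"
  define h where "h f z = poly (Q f) z / (poly (P f) z - c * poly (Q f) z)" for f z
  \<comment> \<open>The inverse of the transformation \<open>1 / (w - c)\<close>, which turns
    \<open>P / Q\<close> into \<open>h f\<close>; it recovers \<open>f\<close> from the bounded
    function.\<close>
  define \<mu> where "\<mu> t = proj (1 + c * t) t" for t
  have key: "poly (P f) z - c * poly (Q f) z \<noteq> 0 \<and> cmod (h f z) \<le> 1 / \<delta> \<and> f (Fin z) = \<mu> (h f z)"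
    if f: "f \<in> F" and z: "z \<in> B" for f z
  proof -
    define p q where "p = poly (P f) z" and "q = poly (Q f) z"
    have pq: "f (Fin z) = proj p q" "p \<noteq> 0 \<or> q \<noteq> 0"
      using PQ[OF f] by (auto simp: poly_rep_def p_def q_def)
    have "f (Fin z) \<notin> U" using omit[OF f] z r by (auto simp: B_def)
    then have le: "\<delta> * cmod q \<le> cmod (p - c * q)"
    proof (cases "q = 0")
      case False
      then have "p / q \<notin> ball c \<delta>" using \<open>f (Fin z) \<notin> U\<close> pq \<delta> by (auto simp: proj_def)
      then have "\<delta> \<le> cmod (p / q - c)" by (simp add: dist_norm norm_minus_commute)
      also have "p / q - c = (p - c * q) / q" using False by (simp add: diff_divide_distrib)
      finally show ?thesis using False by (simp add: norm_divide le_divide_eq)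
    qed simp
    have nz: "p - c * q \<noteq> 0"
    proof
      assume *: "p - c * q = 0"
      then have "q = 0" using le \<delta>(1) by (simp add: mult_le_0_iff)
      then show False using * pq by simp
    qed
    have "cmod (h f z) \<le> 1 / \<delta>"
      using le nz \<delta>(1) unfolding h_def p_def[symmetric] q_def[symmetric]
      by (simp add: norm_divide divide_le_eq le_divide_eq mult.commute)
    moreover have "\<mu> (h f z) = proj p q"
    proof -
      have "\<mu> (h f z) = proj ((p - c * q) * (1 + c * (q / (p - c * q)))) ((p - c * q) * (q / (p - c * q)))"
        unfolding \<mu>_def h_def p_def[symmetric] q_def[symmetric] using nz by (simp only: proj_scale not_False_eq_True)
      also have "(p - c * q) * (q / (p - c * q)) = q" using nz by simp
      also have "(p - c * q) * (1 + c * (q / (p - c * q))) = p - c * q + c * ((p - c * q) * (q / (p - c * q)))"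
        by (simp only: distrib_left mult.left_commute mult_1_right)
      also have "\<dots> = p" using nz by simp
      finally show ?thesis .
    qed
    ultimately show ?thesis using nz pq by (simp add: p_def q_def)
  qed
  have cont: "continuous_on S \<mu>" for S
    unfolding \<mu>_def
    by (intro continuous_at_imp_continuous_on ballI isCont_proj) (auto intro!: continuous_intros)
  \<comment> \<open>Since \<open>\<mu>\<close> is continuous also at zero, where its value is
    \<open>Infty\<close>, uniform convergence of the functions \<open>h f\<close> passes to the maps
    \<open>f\<close>, poles included.\<close>
  then have ucont: "uniformly_continuous_on (cball 0 (1 / \<delta>)) \<mu>"
    by (intro compact_uniformly_continuous) auto
  have "normal_on (Fin ` B) F"
    unfolding normal_on_def
  proof (intro allI impI)
    fix f :: "nat \<Rightarrow> riemann_sphere \<Rightarrow> riemann_sphere" assume "range f \<subseteq> F"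
    then have f: "f n \<in> F" for n by auto
    obtain g s where s: "strict_mono (s :: nat \<Rightarrow> nat)"
      and ptw: "\<And>z. z \<in> B \<Longrightarrow> (\<lambda>n. h (f (s n)) z) \<longlonglongrightarrow> g z"
      and unif: "\<And>K. compact K \<Longrightarrow> K \<subseteq> B \<Longrightarrow> uniform_limit K ((\<lambda>n. h (f n)) \<circ> s) g sequentially"
    proof (rule Montel[of B "h ` F" "\<lambda>n. h (f n)"])
      show "open B" by (simp add: B_def)
      show "k holomorphic_on B" if "k \<in> h ` F" for k
      proof -
        obtain k' where "k' \<in> F" "k = h k'" using \<open>k \<in> h ` F\<close> by blast
        then show ?thesis using key[OF \<open>k' \<in> F\<close>] by (auto simp: h_def[abs_def] intro!: holomorphic_intros)
      qed
      show "\<exists>b. \<forall>k\<in>h ` F. \<forall>z\<in>K. cmod (k z) \<le> b" if "compact K" "K \<subseteq> B" for K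
        using key that by (intro exI[of _ "1 / \<delta>"]) blast
      show "range (\<lambda>n. h (f n)) \<subseteq> h ` F" using f by auto
    qed blast
    have gb: "g z \<in> cball 0 (1 / \<delta>)" if "z \<in> B" for z
    proof -
      have "cmod (g z) \<le> 1 / \<delta>"
        using tendsto_norm[OF ptw[OF that]] key f that by (intro LIMSEQ_le_const2) blast+
      then show ?thesis by simp
    qed
    have "uniform_limit K (\<lambda>n. f (s n)) (\<lambda>p. \<mu> (g (finite_part p))) sequentially"
      if K: "compact K" "K \<subseteq> Fin ` B" for K
      unfolding uniform_limit_iff
    proof (intro allI impI)
      fix e :: real assume "e > 0"
      then obtain d where d: "d > 0"
        "\<And>t t'. t \<in> cball 0 (1 / \<delta>) \<Longrightarrow> t' \<in> cball 0 (1 / \<delta>) \<Longrightarrow> dist t' t < d \<Longrightarrow> dist (\<mu> t') (\<mu> t) < e"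
        using ucont unfolding uniformly_continuous_on_def by metis
      have "compact (finite_part ` K)"
        using K by (intro compact_continuous_image continuous_on_subset[OF continuous_on_finite_part]) auto
      moreover have "finite_part ` K \<subseteq> B" using K by auto
      ultimately have "\<forall>\<^sub>F n in sequentially. \<forall>z\<in>finite_part ` K. dist (((\<lambda>n. h (f n)) \<circ> s) n z) (g z) < d"
        using unif[unfolded uniform_limit_iff] d(1) by blast
      then show "\<forall>\<^sub>F n in sequentially. \<forall>p\<in>K. dist (f (s n) p) (\<mu> (g (finite_part p))) < e"
      proof eventually_elim
        case (elim n)
        show ?case
        proof
          fix p assume p: "p \<in> K"
          then obtain z where z: "p = Fin z" "z \<in> B" using K by auto
          have "dist (h (f (s n)) z) (g z) < d" using elim p z by force
          moreover have "h (f (s n)) z \<in> cball 0 (1 / \<delta>)" using key[OF f z(2)] by simp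
          ultimately have "dist (\<mu> (h (f (s n)) z)) (\<mu> (g z)) < e" using d(2) gb z(2) by blast
          then show "dist (f (s n) p) (\<mu> (g (finite_part p))) < e" using key[OF f z(2)] z by simp
        qed
      qed
    qed
    then show "\<exists>r l. strict_mono r \<and> (\<forall>K. compact K \<and> K \<subseteq> Fin ` B \<longrightarrow> uniform_limit K (\<lambda>n. f (r n)) l sequentially)"
      using s by (intro exI[of _ s] exI[of _ "\<lambda>p. \<mu> (g (finite_part p))"]) blast
  qed
  then show ?thesis
    using open_Fin_image[of B] r(1) by (intro exI[of _ "Fin ` B"]) (simp add: B_def)
qed

lemma normal_near_if_omits:
  assumes rat: "\<And>f. f \<in> F \<Longrightarrow> rational_map f"
    and U: "open U" "U \<noteq> {}" and N: "open N" "x \<in> N"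
    and omit: "\<And>f y. f \<in> F \<Longrightarrow> y \<in> N \<Longrightarrow> f y \<notin> U"
  shows "\<exists>W. open W \<and> x \<in> W \<and> normal_on W F"
proof (cases x)
  case (Fin z)
  then show ?thesis using normal_near_Fin_if_omits[of F U N z] assms rational_map_poly_rep(1) by blast
next
  case Infty
  have "\<exists>W. open W \<and> Fin 0 \<in> W \<and> normal_on W ((\<lambda>f. f \<circ> recip) ` F)"
  proof (rule normal_near_Fin_if_omits[OF _ U])
    show "open (recip ` N)" by (rule open_recip_image[OF N(1)])
    show "Fin 0 \<in> recip ` N" using N(2) Infty by (metis image_eqI recip_Infty)
    show "f y \<notin> U" if "f \<in> (\<lambda>f. f \<circ> recip) ` F" "y \<in> recip ` N" for f y
      using that omit by auto
    show "\<exists>P Q. poly_rep f P Q" if "f \<in> (\<lambda>f. f \<circ> recip) ` F" for f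
      using that rat rational_map_poly_rep(2) by blast
  qed
  then obtain W where W: "open W" "Fin 0 \<in> W" "normal_on W ((\<lambda>f. f \<circ> recip) ` F)" by blast
  have "normal_on (recip ` W) ((\<lambda>f. f \<circ> recip) ` (\<lambda>f. f \<circ> recip) ` F)"
    by (rule normal_on_compose[OF W(3) continuous_on_recip]) auto
  moreover have "(\<lambda>f. f \<circ> recip) ` (\<lambda>f. f \<circ> recip) ` F = F"
    by (simp add: image_image o_def)
  moreover have "x \<in> recip ` W" using W(2) Infty by (metis image_eqI recip_Infty recip_recip)
  ultimately show ?thesis using open_recip_image[OF W(1)] by metis
qed

section \<open>The dynamics on the part of the Fatou set inside the open set\<close>

text \<open>The first letter of a word is the map applied first.\<close>

fun comp_word :: "(nat \<Rightarrow> 'a \<Rightarrow> 'a) \<Rightarrow> nat list \<Rightarrow> 'a \<Rightarrow> 'a" where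
  "comp_word h [] = id"
| "comp_word h (j # w) = comp_word h w \<circ> h j"

lemma comp_word_append: "comp_word h (v @ w) = comp_word h w \<circ> comp_word h v"
  by (induction v) (auto simp: o_assoc)

lemma generated_semigroup_words:
  "generated_semigroup (h ` J) = {comp_word h w |w. w \<noteq> [] \<and> set w \<subseteq> J}"
proof (intro set_eqI iffI)
  fix g assume "g \<in> generated_semigroup (h ` J)"
  then show "g \<in> {comp_word h w |w. w \<noteq> [] \<and> set w \<subseteq> J}"
  proof induction
    case (generator g)
    then obtain j where "j \<in> J" "g = h j" by auto
    then show ?case by (auto intro!: exI[of _ "[j]"])
  next
    case (compose f g)
    then obtain v w where "f = comp_word h v" "g = comp_word h w" "v \<noteq> []" "set v \<subseteq> J" "set w \<subseteq> J"
      by auto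
    then show ?case by (auto intro!: exI[of _ "w @ v"] simp: comp_word_append)
  qed
next
  fix g assume "g \<in> {comp_word h w |w. w \<noteq> [] \<and> set w \<subseteq> J}"
  then obtain w where "g = comp_word h w" "w \<noteq> []" "set w \<subseteq> J" by auto
  moreover have "w \<noteq> [] \<Longrightarrow> set w \<subseteq> J \<Longrightarrow> comp_word h w \<in> generated_semigroup (h ` J)"
  proof (induction w)
    case (Cons j w)
    then show ?case
      by (cases "w = []") (auto simp del: o_apply intro: generated_semigroup.intros)
  qed simp
  ultimately show "g \<in> generated_semigroup (h ` J)" by blast
qed

lemma open_Fatou: "open (Fatou G)"
proof -
  have "Fatou G = \<Union> {W. open W \<and> normal_on W G}" unfolding Fatou_def by blast
  then show ?thesis by auto
qed

locale osc_semigroup =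
  fixes m :: nat and h :: "nat \<Rightarrow> riemann_sphere \<Rightarrow> riemann_sphere"
    and G :: "(riemann_sphere \<Rightarrow> riemann_sphere) set" and U :: "riemann_sphere set"
  assumes m_pos: "m \<ge> 1"
    and semigroup: "rational_semigroup G"
    and generated: "G = generated_semigroup (h ` {1..m})"
    and osc: "open_set_condition m h U"
begin

abbreviation word :: "nat list \<Rightarrow> riemann_sphere \<Rightarrow> riemann_sphere" where
  "word \<equiv> comp_word h"

definition \<Omega> :: "riemann_sphere set" where
  "\<Omega> = U \<inter> Fatou G"

lemma G_words: "G = {word w |w. w \<noteq> [] \<and> set w \<subseteq> {1..m}}"
  unfolding generated generated_semigroup_words ..

lemma word_in_G: "w \<noteq> [] \<Longrightarrow> set w \<subseteq> {1..m} \<Longrightarrow> word w \<in> G"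
  by (auto simp: G_words)

lemma generator_in_G: "j \<in> {1..m} \<Longrightarrow> h j \<in> G"
  using word_in_G[of "[j]"] by simp

lemma rational_G: "g \<in> G \<Longrightarrow> rational_map g"
  and nonconstant_G: "g \<in> G \<Longrightarrow> \<not> g constant_on UNIV"
  using semigroup by (auto simp: rational_semigroup_def)

lemma surj_G: "g \<in> G \<Longrightarrow> surj g"
  by (simp add: rational_map_surj rational_G nonconstant_G)

lemma countable_G: "countable G"
proof -
  have "countable (word ` UNIV)" by (rule countable_image) simp
  then show ?thesis by (rule countable_subset[rotated]) (auto simp: G_words)
qed

lemma open_U: "open U" and U_nonempty: "U \<noteq> {}"
  and generator_back: "j \<in> {1..m} \<Longrightarrow> h j y \<in> U \<Longrightarrow> y \<in> U"
  using osc unfolding open_set_condition_def by blast+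

lemma generator_unique: "i \<in> {1..m} \<Longrightarrow> j \<in> {1..m} \<Longrightarrow> h i y \<in> U \<Longrightarrow> h j y \<in> U \<Longrightarrow> i = j"
  using osc unfolding open_set_condition_def disjoint_family_on_def by blast

lemma word_back: "set w \<subseteq> {1..m} \<Longrightarrow> word w y \<in> U \<Longrightarrow> y \<in> U"
proof (induction w arbitrary: y)
  case (Cons j w)
  then have "h j y \<in> U" "j \<in> {1..m}" by simp_all
  then show ?case by (rule generator_back[rotated])
qed simp

lemma G_back: "g \<in> G \<Longrightarrow> g y \<in> U \<Longrightarrow> y \<in> U"
  using word_back by (auto simp: G_words)

lemma words_comparable:
  assumes "set v \<subseteq> {1..m}" "set w \<subseteq> {1..m}" "word v y \<in> U" "word w y \<in> U"
  shows "\<exists>u. w = v @ u \<or> v = w @ u"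
  using assms
proof (induction v arbitrary: w y)
  case (Cons i v)
  show ?case
  proof (cases w)
    case w: (Cons j w')
    have v: "i \<in> {1..m}" "set v \<subseteq> {1..m}" "word v (h i y) \<in> U" using Cons.prems by simp_all
    have w': "j \<in> {1..m}" "set w' \<subseteq> {1..m}" "word w' (h j y) \<in> U" using Cons.prems w by simp_all
    have "i = j"
      using generator_unique[OF v(1) w'(1) word_back[OF v(2,3)] word_back[OF w'(2,3)]] .
    then show ?thesis using Cons.IH[OF v(2) w'(2) v(3)] w' w by auto
  qed simp
qed auto

lemma words_eq:
  assumes "set v \<subseteq> {1..m}" "set w \<subseteq> {1..m}" "word v y \<in> U" "word w y \<in> U" "length v = length w"
  shows "v = w"
  using words_comparable[OF assms(1-4)] assms(5) by auto

lemma open_\<Omega>: "open \<Omega>"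
  unfolding \<Omega>_def by (intro open_Int open_U open_Fatou)

text \<open>By backward invariance no element of \<open>G\<close> sends a point outside
  \<open>closure U\<close> into \<open>U\<close>, so \<open>G\<close> omits the open set
  \<open>U\<close> there.\<close>

lemma Julia_subset_closure: "Julia G \<subseteq> closure U"
proof
  fix x assume x: "x \<in> Julia G"
  show "x \<in> closure U"
  proof (rule ccontr)
    assume "x \<notin> closure U"
    moreover have "g y \<notin> U" if "g \<in> G" "y \<in> - closure U" for g y
      using G_back[OF that(1)] that(2) closure_subset by blast
    ultimately have "\<exists>W. open W \<and> x \<in> W \<and> normal_on W G"
      by (intro normal_near_if_omits[of G U "- closure U"]) (auto simp: open_U U_nonempty rational_G)
    then show False using x by (auto simp: Julia_def Fatou_def)
  qed
qed

lemma \<Omega>_nonempty: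
  assumes "Julia G \<noteq> closure U"
  shows "\<Omega> \<noteq> {}"
proof
  assume "\<Omega> = {}"
  then have "U \<subseteq> Julia G" by (auto simp: \<Omega>_def Julia_def)
  moreover have "closed (Julia G)" unfolding Julia_def by (rule closed_Compl[OF open_Fatou])
  ultimately have "closure U \<subseteq> Julia G" by (rule closure_minimal)
  then show False using assms Julia_subset_closure by blast
qed

text \<open>The elements of \<open>G\<close> whose first letter is not \<open>j\<close> omit \<open>U\<close> on \<open>h j -` U\<close>; those whose first
  letter is \<open>j\<close> inherit normality through \<open>h j\<close>.\<close>

lemma generator_back_\<Omega>:
  assumes j: "j \<in> {1..m}" and y: "h j y \<in> \<Omega>"
  shows "y \<in> \<Omega>"
proof -
  obtain W\<^sub>0 where W0: "open W\<^sub>0" "h j y \<in> W\<^sub>0" "normal_on W\<^sub>0 G"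
    using y by (auto simp: \<Omega>_def Fatou_def)
  have cont: "continuous_on S (h j)" for S
    using j by (intro rational_map_continuous_on rational_G generator_in_G)
  define N where "N = h j -` (U \<inter> W\<^sub>0)"
  have N: "open N" "y \<in> N"
    using y W0 by (auto simp: N_def \<Omega>_def intro!: open_vimage[OF _ cont] open_U)
  define F where "F = {g \<in> G. \<forall>z\<in>N. g z \<notin> U}"
  obtain W where W: "open W" "y \<in> W" "normal_on W F"
    using normal_near_if_omits[OF _ open_U U_nonempty N, of F] rational_G by (auto simp: F_def)
  have "normal_on (W \<inter> N) ((\<lambda>f. f \<circ> h j) ` G)"
    using normal_on_compose[OF W0(3) cont, of "W \<inter> N"] by (auto simp: N_def)
  \<comment> \<open>The singleton accounts for the word \<open>[j]\<close>: what remains after its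
    first letter is the identity, which need not lie in \<open>G\<close>.\<close>
  then have "normal_on (W \<inter> N) (F \<union> ((\<lambda>f. f \<circ> h j) ` G \<union> {h j}))"
    by (intro normal_on_Un normal_on_singleton normal_on_subset[OF W(3)]) auto
  moreover have "G \<subseteq> F \<union> ((\<lambda>f. f \<circ> h j) ` G \<union> {h j})"
  proof
    fix g assume g: "g \<in> G"
    then obtain i w where w: "g = word (i # w)" "i \<in> {1..m}" "set w \<subseteq> {1..m}"
      by (auto simp: G_words neq_Nil_conv)
    show "g \<in> F \<union> ((\<lambda>f. f \<circ> h j) ` G \<union> {h j})"
    proof (cases "i = j")
      case True
      then show ?thesis using w word_in_G[of w] by (cases "w = []") auto
    next
      case False
      have "g z \<notin> U" if "z \<in> N" for z
      proof
        assume "g z \<in> U"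
        then have "h i z \<in> U" using w word_back[of w "h i z"] by simp
        moreover have "h j z \<in> U" using that by (simp add: N_def)
        ultimately show False using False generator_unique w j by blast
      qed
      then show ?thesis using g by (auto simp: F_def)
    qed
  qed
  ultimately have "normal_on (W \<inter> N) G" by (rule normal_on_mono)
  then have "y \<in> Fatou G" using W N by (auto simp: Fatou_def)
  then show ?thesis using y generator_back[OF j] by (auto simp: \<Omega>_def)
qed

section \<open>Wandering sets and recurrence\<close>

lemma equicontinuous_words:
  assumes "x \<in> Fatou G" "e > 0"
  shows "\<exists>d>0. \<forall>y w. set w \<subseteq> {1..m} \<longrightarrow> dist y x < d \<longrightarrow> dist (word w y) (word w x) < e"
proof -
  obtain W where W: "open W" "x \<in> W" "normal_on W G" using assms by (auto simp: Fatou_def)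
  obtain d where d: "d > 0" "\<And>y f. dist y x < d \<Longrightarrow> f \<in> G \<Longrightarrow> dist (f y) (f x) < e"
    using normal_on_equicontinuous[OF W(3,1,2) rational_map_continuous_on[OF rational_G] assms(2)] by blast
  \<comment> \<open>The bound \<open>e\<close> in the minimum serves the empty word, which acts as
    the identity.\<close>
  have "dist (word w y) (word w x) < e" if "set w \<subseteq> {1..m}" "dist y x < min d e" for y w
    using that d(2)[OF _ word_in_G] by (cases "w = []") auto
  moreover have "min d e > 0" using d assms by simp
  ultimately show ?thesis by blast
qed

text \<open>Returns are expressed through words and not through elements of \<open>G\<close>,
  because the argument concatenates words and reads off their first letters.\<close>

definition recurrent :: bool where
  "recurrent \<longleftrightarrow> (\<forall>x\<in>\<Omega>. \<forall>e>0. \<exists>w. w \<noteq> [] \<and> set w \<subseteq> {1..m} \<and> dist (word w x) x < e)"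

lemma wandering_or_recurrent:
  obtains V where "open V" "V \<noteq> {}" "V \<subseteq> \<Omega>" "\<And>g y. g \<in> G \<Longrightarrow> y \<in> V \<Longrightarrow> g y \<notin> V"
  | recurrent
proof (cases "\<exists>V. open V \<and> V \<noteq> {} \<and> V \<subseteq> \<Omega> \<and> (\<forall>g\<in>G. \<forall>y\<in>V. g y \<notin> V)")
  case False
  have recurrent
    unfolding recurrent_def
  proof (intro ballI allI impI)
    fix x e assume x: "x \<in> \<Omega>" and e: "(e::real) > 0"
    then obtain d where d: "d > 0"
      "\<And>y w. set w \<subseteq> {1..m} \<Longrightarrow> dist y x < d \<Longrightarrow> dist (word w y) (word w x) < e / 2"
      using equicontinuous_words[of x "e / 2"] by (auto simp: \<Omega>_def)
    \<comment> \<open>The radius \<open>d\<close> lets \<open>word w x\<close> be compared with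
      \<open>word w y\<close> at cost \<open>e / 2\<close>; the radius \<open>e / 2\<close> accounts
      for the distance from \<open>word w y\<close> to \<open>x\<close>.\<close>
    define V where "V = ball x (min d (e / 2)) \<inter> \<Omega>"
    have "x \<in> V" using x d(1) e by (simp add: V_def)
    then have "V \<noteq> {}" by blast
    moreover have "open V" "V \<subseteq> \<Omega>" using open_\<Omega> by (auto simp: V_def)
    ultimately obtain g y where gy: "g \<in> G" "y \<in> V" "g y \<in> V" using False by blast
    then obtain w where w: "w \<noteq> []" "set w \<subseteq> {1..m}" "g = word w" by (auto simp: G_words)
    have "dist y x < d" "dist (word w y) x < e / 2"
      using gy w(3) by (auto simp: V_def dist_commute)
    then have "dist (word w x) x < e"
      using d(2)[OF w(2), of y] dist_triangle2[of "word w x" x "word w y"]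
        dist_triangle[of "word w x" x "word w y"] by (simp add: dist_commute)
    then show "\<exists>w. w \<noteq> [] \<and> set w \<subseteq> {1..m} \<and> dist (word w x) x < e" using w by blast
  qed
  then show ?thesis by (rule that)
qed (use that in blast)

text \<open>If the word \<open>i # v\<close> almost fixes \<open>y\<^sub>1\<close> and \<open>j # w\<close> almost fixes \<open>y\<^sub>2\<close>, then \<open>w @ j # v\<close>
  and \<open>v @ i # w\<close> send the common image \<open>x\<close> close to \<open>y\<^sub>1\<close> and \<open>y\<^sub>2\<close> respectively. Both values lie in
  \<open>U\<close>, so these two words of equal length agree.\<close>

lemma recurrent_preimage_unique:
  assumes rec: recurrent and ij: "i \<in> {1..m}" "j \<in> {1..m}"
    and x: "h i y\<^sub>1 = x" "h j y\<^sub>2 = x" "x \<in> \<Omega>"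
  shows "y\<^sub>1 = y\<^sub>2"
proof (rule ccontr)
  assume ne: "y\<^sub>1 \<noteq> y\<^sub>2"
  have y: "y\<^sub>1 \<in> \<Omega>" "y\<^sub>2 \<in> \<Omega>" 
    by (rule generator_back_\<Omega>[OF ij(1)], simp add: x, rule generator_back_\<Omega>[OF ij(2)], simp add: x)
  obtain \<eta>\<^sub>1 \<eta>\<^sub>2 where \<eta>: "\<eta>\<^sub>1 > 0" "ball y\<^sub>1 \<eta>\<^sub>1 \<subseteq> U" "\<eta>\<^sub>2 > 0" "ball y\<^sub>2 \<eta>\<^sub>2 \<subseteq> U"
    using y open_U by (metis IntD1 \<Omega>_def open_contains_ball)
  \<comment> \<open>Balls of radius \<open>2 * e\<close> lie in \<open>U\<close>, so that images
    with that error can be compared by \<open>words_eq\<close>; two such errors add up to less than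
    \<open>dist y\<^sub>1 y\<^sub>2\<close>.\<close>
  define e where "e = min (dist y\<^sub>1 y\<^sub>2 / 4) (min \<eta>\<^sub>1 \<eta>\<^sub>2 / 2)"
  have e: "e > 0" "4 * e \<le> dist y\<^sub>1 y\<^sub>2" "2 * e \<le> \<eta>\<^sub>1" "2 * e \<le> \<eta>\<^sub>2"
    using ne \<eta> by (auto simp: e_def)
  obtain d\<^sub>1 where d1: "d\<^sub>1 > 0"
    "\<And>y w. set w \<subseteq> {1..m} \<Longrightarrow> dist y y\<^sub>1 < d\<^sub>1 \<Longrightarrow> dist (word w y) (word w y\<^sub>1) < e"
    using equicontinuous_words[of y\<^sub>1 e] y e by (auto simp: \<Omega>_def)
  obtain d\<^sub>2 where d2: "d\<^sub>2 > 0"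
    "\<And>y w. set w \<subseteq> {1..m} \<Longrightarrow> dist y y\<^sub>2 < d\<^sub>2 \<Longrightarrow> dist (word w y) (word w y\<^sub>2) < e"
    using equicontinuous_words[of y\<^sub>2 e] y e by (auto simp: \<Omega>_def)
  \<comment> \<open>A word that nearly fixes \<open>z\<close> sends \<open>h l z\<close> into
    \<open>U\<close>, where \<open>l\<close> is its first letter. As \<open>h k z\<close> is in
    \<open>U\<close> too, \<open>l = k\<close>, and the rest of the word sends \<open>x\<close>
    close to \<open>z\<close>.\<close>
  have step: "\<exists>v. set v \<subseteq> {1..m} \<and> dist (word v x) z < min e d"
    if "k \<in> {1..m}" "h k z = x" "z \<in> \<Omega>" "d > 0" "ball z (2 * e) \<subseteq> U" for k z d
  proof -
    have "min e d > 0" using that e by simp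
    then obtain v where v: "v \<noteq> []" "set v \<subseteq> {1..m}" "dist (word v z) z < min e d"
      using rec \<open>z \<in> \<Omega>\<close> unfolding recurrent_def by blast
    then obtain l v' where l: "v = l # v'" by (auto simp: neq_Nil_conv)
    have "word v z \<in> U" using that(5) v(3) e by (auto simp: dist_commute subset_iff)
    then have "h l z \<in> U" using word_back[of v' "h l z"] v(2) l by simp
    moreover have "h k z \<in> U" using that x by (simp add: \<Omega>_def)
    ultimately have "l = k" using generator_unique that(1) v(2) l by auto
    then show ?thesis using v l that(2) by auto
  qed
  have sub: "ball y\<^sub>1 (2 * e) \<subseteq> U" "ball y\<^sub>2 (2 * e) \<subseteq> U"
    using \<eta> e by (meson order_trans subset_ball)+
  obtain v where v: "set v \<subseteq> {1..m}" "dist (word v x) y\<^sub>1 < min e d\<^sub>1"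
    using step[OF ij(1) x(1) y(1) d1(1) sub(1)] by blast
  obtain w where w: "set w \<subseteq> {1..m}" "dist (word w x) y\<^sub>2 < min e d\<^sub>2"
    using step[OF ij(2) x(2) y(2) d2(1) sub(2)] by blast
  \<comment> \<open>Equicontinuity at \<open>y\<^sub>2\<close> applies because
    \<open>word w x\<close> is close to it; \<open>j # v\<close> sends \<open>y\<^sub>2\<close>
    through \<open>x\<close> to a point near \<open>y\<^sub>1\<close>.\<close>
  have "dist (word (j # v) (word w x)) (word (j # v) y\<^sub>2) < e"
    using d2(2)[of "j # v" "word w x"] v w ij by simp
  then have A: "dist (word (w @ j # v) x) y\<^sub>1 < 2 * e"
    using v(2) x dist_triangle[of "word (w @ j # v) x" y\<^sub>1 "word v x"] by (simp add: comp_word_append)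
  have "dist (word (i # w) (word v x)) (word (i # w) y\<^sub>1) < e"
    using d1(2)[of "i # w" "word v x"] v w ij by simp
  then have B: "dist (word (v @ i # w) x) y\<^sub>2 < 2 * e"
    using w(2) x dist_triangle[of "word (v @ i # w) x" y\<^sub>2 "word w x"] by (simp add: comp_word_append)
  have "word (w @ j # v) x \<in> U" "word (v @ i # w) x \<in> U"
    using A B sub by (auto simp: dist_commute subset_iff)
  then have "w @ j # v = v @ i # w"
    using v w ij by (intro words_eq) auto
  then have "dist y\<^sub>1 y\<^sub>2 < 4 * e"
    using A B dist_triangle3[of y\<^sub>1 y\<^sub>2 "word (w @ j # v) x"] by simp
  then show False using e by simp
qed

text \<open>Surjectivity gives a point of \<open>\<Omega>\<close> preimages under two generators.
  Recurrence makes them coincide, against the disjointness in the open set condition.\<close>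

lemma recurrent_one_generator:
  assumes recurrent "\<Omega> \<noteq> {}"
  shows "m = 1"
proof (rule ccontr)
  assume "m \<noteq> 1"
  then have m: "1 \<in> {1..m}" "2 \<in> {1..m}" using m_pos by auto
  obtain x where x: "x \<in> \<Omega>" using assms by blast
  obtain y\<^sub>1 y\<^sub>2 where y: "h 1 y\<^sub>1 = x" "h 2 y\<^sub>2 = x"
    using surj_G[OF generator_in_G[OF m(1)]] surj_G[OF generator_in_G[OF m(2)]] by (metis surjD)
  then have "y\<^sub>1 = y\<^sub>2" using recurrent_preimage_unique[OF assms(1) m] x by blast
  then have "(1::nat) = 2" using generator_unique[OF m, of y\<^sub>1] x y by (auto simp: \<Omega>_def)
  then show False by simp
qed

text \<open>Of two comparable words one extends the other by some \<open>u\<close>. A nonempty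
  \<open>u\<close> would send a point of \<open>V\<close> back into \<open>V\<close>. Equality of
  maps is the right conclusion, as the Poincare series runs over maps and not over words.\<close>

lemma wandering_disjoint:
  assumes V: "V \<subseteq> U" "\<And>g y. g \<in> G \<Longrightarrow> y \<in> V \<Longrightarrow> g y \<notin> V"
    and fg: "f \<in> G" "g \<in> G" "f y \<in> V" "g y \<in> V"
  shows "f = g"
proof -
  obtain v w where vw: "f = word v" "set v \<subseteq> {1..m}" "g = word w" "set w \<subseteq> {1..m}"
    using fg by (auto simp: G_words)
  have "u = []" if "word (v @ u) y \<in> V" "word v y \<in> V" "set u \<subseteq> {1..m}" for u v
    using that V(2)[OF word_in_G, of u "word v y"] by (auto simp: comp_word_append)
  moreover obtain u where "w = v @ u \<or> v = w @ u"
    using words_comparable[of v w y] vw fg V(1) by blast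
  ultimately show ?thesis using vw fg by (metis append_Nil2 le_sup_iff set_append)
qed

end

section \<open>Maps with unique preimages and recurrent Moebius transformations\<close>

lemma open_avoids_finite:
  assumes "open S" "S \<noteq> {}" "finite T"
  obtains z where "Fin z \<in> S" "z \<notin> T"
proof -
  have "infinite (Fin -` S)"
    using open_vimage_Fin[OF assms(1)] vimage_Fin_nonempty[OF assms(1,2)] finite_imp_not_open by blast
  then have "\<not> Fin -` S \<subseteq> T" using assms(3) finite_subset by blast
  then show ?thesis using that by blast
qed

section \<open>Moebius transformations in homogeneous coordinates\<close>

lemma homogeneous_cases:
  obtains z w where "p = proj z w" "z \<noteq> 0 \<or> w \<noteq> 0"
proof (cases p)
  case (Fin z)
  then show ?thesis using that[of z 1] by (simp add: proj_def)
next
  case Infty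
  then show ?thesis using that[of 1 0] by (simp add: proj_def)
qed

text \<open>A Moebius transformation acts on homogeneous coordinates as a matrix, so inversion and
  conjugation become linear identities without a separate case for \<open>Infty\<close>.\<close>

lemma moebius_proj:
  assumes "a * d - b * c \<noteq> 0" "z \<noteq> 0 \<or> w \<noteq> 0"
  shows "ratio_map [:b, a:] [:d, c:] (proj z w) = proj (a * z + b * w) (c * z + d * w)"
proof (cases "w = 0")
  case True
  have "a \<noteq> 0 \<or> c \<noteq> 0" using assms(1) by auto
  then have "max (degree [:b, a:]) (degree [:d, c:]) = 1" by auto
  then show ?thesis using True assms(2) by (simp add: proj_def)
next
  case False
  have "b + z * a / w = (a * z + b * w) / w" "d + z * c / w = (c * z + d * w) / w"
    using False by (simp_all add: field_simps)
  then show ?thesis using False by (simp add: proj_def)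
qed

lemma moebius_rational:
  assumes "a * d - b * c \<noteq> (0::complex)"
  shows "rational_map (ratio_map [:b, a:] [:d, c:])"
proof -
  have "coprime [:b, a:] [:d, c:]"
  proof (rule coprimeI)
    fix k assume "k dvd [:b, a:]" "k dvd [:d, c:]"
    \<comment> \<open>This combination cancels the linear terms and leaves minus the
      determinant.\<close>
    then have "k dvd smult c [:b, a:] - smult a [:d, c:]" by (intro dvd_diff dvd_smult)
    also have "smult c [:b, a:] - smult a [:d, c:] = [:b * c - a * d:]" by (simp add: mult.commute)
    finally show "is_unit k"
      using assms by (metis dvd_trans eq_iff_diff_eq_0 is_unit_const_poly_iff dvd_field_iff minus_diff_eq neg_equal_0_iff_equal)
  qed
  then show ?thesis by (auto simp: rational_map_def)
qed

lemma moebius_inj: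
  assumes "a * d - b * c \<noteq> (0::complex)"
  shows "inj (ratio_map [:b, a:] [:d, c:])"
proof (rule injI)
  fix x y assume eq: "ratio_map [:b, a:] [:d, c:] x = ratio_map [:b, a:] [:d, c:] y"
  \<comment> \<open>The adjugate matrix inverts up to the scalar \<open>a * d - b * c\<close>, which
    \<open>proj\<close> does not see.\<close>
  have inv: "ratio_map [:- b, d:] [:a, - c:] (ratio_map [:b, a:] [:d, c:] x) = x" for x
  proof -
    obtain z w where x: "x = proj z w" "z \<noteq> 0 \<or> w \<noteq> 0" by (rule homogeneous_cases)
    have det: "d * (a * z + b * w) + - b * (c * z + d * w) = (a * d - b * c) * z"
      "- c * (a * z + b * w) + a * (c * z + d * w) = (a * d - b * c) * w"
      by (simp_all add: algebra_simps)
    then have "a * z + b * w \<noteq> 0 \<or> c * z + d * w \<noteq> 0" using assms x(2) by auto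
    moreover have "d * a - - b * - c \<noteq> 0" using assms by (simp add: mult.commute)
    ultimately have "ratio_map [:- b, d:] [:a, - c:] (ratio_map [:b, a:] [:d, c:] x)
        = proj (d * (a * z + b * w) + - b * (c * z + d * w)) (- c * (a * z + b * w) + a * (c * z + d * w))"
      unfolding x(1) using moebius_proj[OF assms x(2)] moebius_proj by simp
    also have "\<dots> = proj z w" unfolding det using assms by (simp add: proj_scale)
    finally show ?thesis using x by simp
  qed
  show "x = y" using inv[of x] inv[of y] unfolding eq by (rule trans[OF sym])
qed

text \<open>Triangular form of a \<open>2 \<times> 2\<close> matrix with respect to a basis of row vectors; as Moebius
  transformations, these become the coordinate in which the map is affine.\<close>

lemma left_eigenvectors:
  fixes a b c d :: complex
  assumes det: "a * d - b * c \<noteq> 0"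
  obtains p q r s l\<^sub>1 l\<^sub>2 t where "p * s - q * r \<noteq> 0" "l\<^sub>1 \<noteq> 0" "l\<^sub>2 \<noteq> 0" "t = 0 \<or> l\<^sub>1 = l\<^sub>2"
    "p * a + q * c = l\<^sub>1 * p + t * r" "p * b + q * d = l\<^sub>1 * q + t * s"
    "r * a + s * c = l\<^sub>2 * r" "r * b + s * d = l\<^sub>2 * s"
proof (cases "c = 0")
  case True
  then have "a \<noteq> 0" "d \<noteq> 0" using det by auto
  show ?thesis
  proof (cases "a = d")
    case True
    show ?thesis
      by (rule that[where p = 1 and q = 0 and r = 0 and s = 1 and l\<^sub>1 = a and l\<^sub>2 = a and t = b])
        (simp_all add: \<open>c = 0\<close> \<open>a \<noteq> 0\<close> True[symmetric])
  next
    case False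
    show ?thesis
      by (rule that[where p = "a - d" and q = b and r = 0 and s = 1 and l\<^sub>1 = a and l\<^sub>2 = d and t = 0])
        (simp_all add: \<open>c = 0\<close> \<open>a \<noteq> 0\<close> \<open>d \<noteq> 0\<close> False algebra_simps)
  qed
next
  case False
  \<comment> \<open>The characteristic polynomial; \<open>l\<close> and \<open>m\<close> are its two
    roots, with sum \<open>a + d\<close>.\<close>
  define T where "T = [:a * d - b * c, - (a + d), 1:]"
  have "\<not> constant (poly T)" by (simp add: constant_degree T_def)
  then obtain l where "poly T l = 0" using fundamental_theorem_of_algebra by blast
  then have l: "(l - a) * (l - d) = b * c" by (simp add: T_def algebra_simps)
  define m where "m = a + d - l"
  have lm: "l * m = a * d - b * c" using l by (simp add: m_def algebra_simps)
  then have nz: "l \<noteq> 0" "m \<noteq> 0" using det by auto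
  \<comment> \<open>The second coordinate of the eigenvector equation for the row vector
    \<open>(c, k - a)\<close>; the first one is an identity.\<close>
  have row: "c * b + (k - a) * d = k * (k - a)" if "k = l \<or> k = m" for k
  proof -
    have "(m - a) * (m - d) = (l - a) * (l - d)" by (simp add: m_def algebra_simps)
    then have "(k - a) * (k - d) = b * c" using that l by auto
    then show ?thesis by (simp add: algebra_simps)
  qed
  show ?thesis
  proof (cases "l = m")
    case True
    then have "d = l + (l - a)" by (simp add: m_def)
    \<comment> \<open>For a double eigenvalue, \<open>(0, 1)\<close> completes the eigenvector
      \<open>(c, l - a)\<close> to a Jordan basis.\<close>
    show ?thesis
      by (rule that[where p = 0 and q = 1 and r = c and s = "l - a" and l\<^sub>1 = l and l\<^sub>2 = l and t = 1])
        (use \<open>c \<noteq> 0\<close> nz row[of l] \<open>d = l + (l - a)\<close> in \<open>simp_all add: mult.commute\<close>, simp add: algebra_simps)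
  next
    case neq: False
    have "c * (m - a) - (l - a) * c = c * (m - l)" by (simp add: algebra_simps)
    then have "c * (m - a) - (l - a) * c \<noteq> 0" using False neq by simp
    show ?thesis
      by (rule that[where p = c and q = "l - a" and r = c and s = "m - a" and l\<^sub>1 = l and l\<^sub>2 = m and t = 0])
        (use \<open>c * (m - a) - (l - a) * c \<noteq> 0\<close> nz row[of l] row[of m] in \<open>simp_all\<close>, simp_all add: algebra_simps)
  qed
qed

text \<open>The moduli of the powers move away from one monotonically, so the first power is the
  worst case.\<close>

lemma power_away_from_one:
  assumes "cmod k \<noteq> 1" "n \<ge> 1"
  shows "cmod (k ^ n - 1) \<ge> \<bar>cmod k - 1\<bar>"
proof -
  have "cmod (k ^ n - 1) \<ge> \<bar>cmod k ^ n - 1\<bar>"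
    using norm_triangle_ineq3[of "k ^ n" 1] by (simp add: norm_power)
  moreover have "\<bar>cmod k ^ n - 1\<bar> \<ge> \<bar>cmod k - 1\<bar>"
  proof (cases "cmod k \<ge> 1")
    case True
    then have "cmod k ^ 1 \<le> cmod k ^ n" using assms by (intro power_increasing) auto
    then show ?thesis using True by simp
  next
    case False
    then have "cmod k ^ n \<le> cmod k ^ 1" using assms by (intro power_decreasing) auto
    then show ?thesis using False by simp
  qed
  ultimately show ?thesis by simp
qed

text \<open>In the coordinate \<open>\<phi>\<close> the map becomes
  \<open>\<kappa> * \<zeta> + \<tau>\<close> with \<open>\<tau> = 0\<close> or
  \<open>\<kappa> = 1\<close>. Excluding the identity and rotations leaves scalings with
  \<open>cmod \<kappa> \<noteq> 1\<close> and nontrivial translations, whose iterates keep a uniform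
  distance from the starting point.\<close>

lemma moebius_not_recurrent:
  assumes f: "moebius f" "f \<noteq> id" "\<not> elliptic f" and S: "open S" "S \<noteq> {}"
  shows "\<exists>x\<in>S. \<exists>e>0. \<forall>n\<ge>1. dist ((f ^^ n) x) x \<ge> e"
proof -
  obtain a b c d where det: "a * d - b * c \<noteq> 0" and f_eq: "f = ratio_map [:b, a:] [:d, c:]"
    using f(1) by (auto simp: moebius_def)
  obtain p q r s l\<^sub>1 l\<^sub>2 t where det': "p * s - q * r \<noteq> 0" and nz: "l\<^sub>1 \<noteq> 0" "l\<^sub>2 \<noteq> 0"
    and t: "t = 0 \<or> l\<^sub>1 = l\<^sub>2"
    and rows: "p * a + q * c = l\<^sub>1 * p + t * r" "p * b + q * d = l\<^sub>1 * q + t * s"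
      "r * a + s * c = l\<^sub>2 * r" "r * b + s * d = l\<^sub>2 * s"
    by (rule left_eigenvectors[OF det])
  define \<phi> where "\<phi> = ratio_map [:q, p:] [:s, r:]"
  have \<phi>: "\<phi> (proj z w) = proj (p * z + q * w) (r * z + s * w)"
    "p * z + q * w \<noteq> 0 \<or> r * z + s * w \<noteq> 0" if "z \<noteq> 0 \<or> w \<noteq> 0" for z w
  proof -
    have "s * (p * z + q * w) - q * (r * z + s * w) = (p * s - q * r) * z"
      "p * (r * z + s * w) - r * (p * z + q * w) = (p * s - q * r) * w"
      by (simp_all add: algebra_simps)
    then show "p * z + q * w \<noteq> 0 \<or> r * z + s * w \<noteq> 0" using that det' by auto
    show "\<phi> (proj z w) = proj (p * z + q * w) (r * z + s * w)"
      unfolding \<phi>_def by (rule moebius_proj[OF det' that])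
  qed
  have fproj: "f (proj z w) = proj (a * z + b * w) (c * z + d * w)"
    "a * z + b * w \<noteq> 0 \<or> c * z + d * w \<noteq> 0" if "z \<noteq> 0 \<or> w \<noteq> 0" for z w
  proof -
    have "d * (a * z + b * w) - b * (c * z + d * w) = (a * d - b * c) * z"
      "a * (c * z + d * w) - c * (a * z + b * w) = (a * d - b * c) * w"
      by (simp_all add: algebra_simps)
    then show "a * z + b * w \<noteq> 0 \<or> c * z + d * w \<noteq> 0" using that det by auto
    show "f (proj z w) = proj (a * z + b * w) (c * z + d * w)"
      unfolding f_eq by (rule moebius_proj[OF det that])
  qed
  have conj: "\<phi> (f (proj z w)) = proj (l\<^sub>1 * (p * z + q * w) + t * (r * z + s * w)) (l\<^sub>2 * (r * z + s * w))"
    if zw: "z \<noteq> 0 \<or> w \<noteq> 0" for z w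
  proof -
    have "p * (a * z + b * w) + q * (c * z + d * w) = (p * a + q * c) * z + (p * b + q * d) * w"
      "r * (a * z + b * w) + s * (c * z + d * w) = (r * a + s * c) * z + (r * b + s * d) * w"
      by (simp_all add: algebra_simps)
    then have "p * (a * z + b * w) + q * (c * z + d * w) = l\<^sub>1 * (p * z + q * w) + t * (r * z + s * w)"
      "r * (a * z + b * w) + s * (c * z + d * w) = l\<^sub>2 * (r * z + s * w)"
      unfolding rows by (simp_all add: algebra_simps)
    then show ?thesis using \<phi>(1)[OF fproj(2)[OF zw]] fproj(1)[OF zw] by simp
  qed
  define \<kappa> \<tau> where "\<kappa> = l\<^sub>1 / l\<^sub>2" and "\<tau> = t / l\<^sub>2"
  have step: "\<phi> (f x) = Fin (\<kappa> * \<zeta> + \<tau>)" if "\<phi> x = Fin \<zeta>" for x \<zeta>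
  proof -
    obtain z w where x: "x = proj z w" "z \<noteq> 0 \<or> w \<noteq> 0" by (rule homogeneous_cases)
    have "proj (p * z + q * w) (r * z + s * w) = Fin \<zeta>" using that x \<phi> by simp
    moreover define v where "v = r * z + s * w"
    ultimately have v: "v \<noteq> 0" "p * z + q * w = \<zeta> * v"
      by (auto simp: proj_def split: if_splits)
    have "\<phi> (f x) = proj (l\<^sub>1 * (\<zeta> * v) + t * v) (l\<^sub>2 * v)"
      using conj[OF x(2)] unfolding x(1) v(2) v_def[symmetric] .
    also have "\<dots> = Fin ((l\<^sub>1 * (\<zeta> * v) + t * v) / (l\<^sub>2 * v))" using v nz by (simp add: proj_def)
    also have "(l\<^sub>1 * (\<zeta> * v) + t * v) / (l\<^sub>2 * v) = \<kappa> * \<zeta> + \<tau>"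
      using v nz by (simp add: \<kappa>_def \<tau>_def field_simps)
    finally show ?thesis .
  qed
  \<comment> \<open>The coordinates \<open>0\<close> and \<open>Infty\<close> are avoided because a
    scaling fixes them.\<close>
  obtain \<zeta> x where \<zeta>: "x \<in> S" "\<phi> x = Fin \<zeta>" "\<zeta> \<noteq> 0"
  proof -
    have "finite {z. poly ([:q, p:] * [:s, r:]) z = 0}"
      using det' by (intro poly_roots_finite) auto
    then obtain z where z: "Fin z \<in> S" "z \<notin> {z. poly ([:q, p:] * [:s, r:]) z = 0}"
      by (rule open_avoids_finite[OF S])
    then have "q + z * p \<noteq> 0" "s + z * r \<noteq> 0" by (auto simp only: poly_mult mem_Collect_eq poly_pCons poly_0) auto
    then show ?thesis using that[of "Fin z" "(q + z * p) / (s + z * r)"] z(1) by (auto simp: \<phi>_def)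
  qed
  have "\<exists>\<eta>>0. \<forall>n\<ge>1. \<exists>\<xi>. \<phi> ((f ^^ n) x) = Fin \<xi> \<and> cmod (\<xi> - \<zeta>) \<ge> \<eta>"
  proof (cases "\<tau> = 0")
    case True
    have "\<phi> ((f ^^ n) x) = Fin (\<kappa> ^ n * \<zeta>)" for n
    proof (induction n)
      case (Suc n)
      then show ?case using step[of "(f ^^ n) x"] True by (simp add: mult.assoc)
    qed (simp add: \<zeta>)
    moreover have "cmod \<kappa> \<noteq> 1"
    proof
      assume \<kappa>: "cmod \<kappa> = 1"
      have t0: "t = 0" using True nz by (simp add: \<tau>_def)
      show False
      proof (cases "\<kappa> = 1")
        case True
        then have l: "l\<^sub>1 = l\<^sub>2" using nz by (simp add: \<kappa>_def)
        have "f x = x" for x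
        proof -
          obtain z w where x: "x = proj z w" "z \<noteq> 0 \<or> w \<noteq> 0" by (rule homogeneous_cases)
          then have "\<phi> (f x) = \<phi> x" using conj \<phi> t0 l nz by (simp add: proj_scale)
          moreover have "inj \<phi>" using moebius_inj[OF det'] by (simp add: \<phi>_def)
          ultimately show ?thesis by (simp add: inj_eq)
        qed
        then show False using f(2) by auto
      next
        case False
        have "\<phi> (f x) = ratio_map [:0, \<kappa>:] [:1, 0:] (\<phi> x)" for x
        proof -
          obtain z w where x: "x = proj z w" "z \<noteq> 0 \<or> w \<noteq> 0" by (rule homogeneous_cases)
          have "\<kappa> * 1 - 0 * 0 \<noteq> 0" using nz by (simp add: \<kappa>_def)
          note mp = moebius_proj[OF this \<phi>(2)[OF x(2)]]
          have "\<phi> (f x) = proj (l\<^sub>2 * (\<kappa> * (p * z + q * w))) (l\<^sub>2 * (r * z + s * w))"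
            using conj[OF x(2)] x(1) t0 nz by (simp add: \<kappa>_def)
          then show ?thesis using mp \<phi>(1)[OF x(2)] x(1) nz by (simp add: proj_scale)
        qed
        then have "\<phi> \<circ> f = ratio_map [:0, \<kappa>:] 1 \<circ> \<phi>" by (auto simp: one_pCons)
        moreover have "moebius \<phi>" using det' by (auto simp: moebius_def \<phi>_def)
        ultimately show False using f \<kappa> False unfolding elliptic_def by blast
      qed
    qed
    then have "\<forall>n\<ge>1. cmod (\<kappa> ^ n * \<zeta> - \<zeta>) \<ge> \<bar>cmod \<kappa> - 1\<bar> * cmod \<zeta>"
    proof (intro allI impI)
      fix n :: nat assume "cmod \<kappa> \<noteq> 1" "n \<ge> 1"
      have "\<kappa> ^ n * \<zeta> - \<zeta> = (\<kappa> ^ n - 1) * \<zeta>" by (simp add: algebra_simps)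
      then show "cmod (\<kappa> ^ n * \<zeta> - \<zeta>) \<ge> \<bar>cmod \<kappa> - 1\<bar> * cmod \<zeta>"
        using power_away_from_one[OF \<open>cmod \<kappa> \<noteq> 1\<close> \<open>n \<ge> 1\<close>] by (simp add: norm_mult mult_right_mono)
    qed
    moreover have "\<bar>cmod \<kappa> - 1\<bar> * cmod \<zeta> > 0" using \<open>cmod \<kappa> \<noteq> 1\<close> \<zeta>(3) by simp
    ultimately show ?thesis by blast
  next
    case False
    then have \<kappa>: "\<kappa> = 1" using t nz by (auto simp: \<tau>_def \<kappa>_def)
    have "\<phi> ((f ^^ n) x) = Fin (\<zeta> + of_nat n * \<tau>)" for n
    proof (induction n)
      case (Suc n)
      then show ?case using step[of "(f ^^ n) x"] \<kappa> by (simp add: algebra_simps)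
    qed (simp add: \<zeta>)
    moreover have "cmod (of_nat n * \<tau>) \<ge> cmod \<tau>" if "n \<ge> 1" for n
      using that by (simp add: norm_mult mult_le_cancel_right1)
    ultimately show ?thesis using False by (intro exI[of _ "cmod \<tau>"]) auto
  qed
  then obtain \<eta> where \<eta>: "\<eta> > 0" "\<And>n. n \<ge> 1 \<Longrightarrow> \<exists>\<xi>. \<phi> ((f ^^ n) x) = Fin \<xi> \<and> cmod (\<xi> - \<zeta>) \<ge> \<eta>" by blast
  have "continuous_on UNIV \<phi>"
    unfolding \<phi>_def by (rule rational_map_continuous_on[OF moebius_rational[OF det']])
  then have "open (\<phi> -` Fin ` ball \<zeta> \<eta>)" by (intro open_vimage open_Fin_image) auto
  moreover have "x \<in> \<phi> -` Fin ` ball \<zeta> \<eta>" using \<zeta>(2) \<eta>(1) by simp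
  ultimately obtain e where e: "e > 0" "\<And>y. dist y x < e \<Longrightarrow> \<phi> y \<in> Fin ` ball \<zeta> \<eta>"
    unfolding open_dist by blast
  have "dist ((f ^^ n) x) x \<ge> e" if n: "n \<ge> 1" for n
  proof (rule ccontr)
    assume "\<not> ?thesis"
    then have "\<phi> ((f ^^ n) x) \<in> Fin ` ball \<zeta> \<eta>" using e(2) by simp
    then show False using \<eta>(2)[OF n] by (auto simp: dist_norm norm_minus_commute)
  qed
  then show ?thesis using \<zeta>(1) e(1) by blast
qed

section \<open>Rational maps with single preimages have degree one\<close>

text \<open>At a root of \<open>Q\<close> the left side vanishes at least to the order of
  \<open>Q\<close>, while the right side vanishes to one order less, since \<open>P\<close> is
  nonzero there and differentiation lowers the order by one.\<close>

lemma degree_0_if_wronskian_0: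
  fixes P Q :: "complex poly"
  assumes nz: "\<And>z. poly P z \<noteq> 0 \<or> poly Q z \<noteq> 0" and W: "pderiv P * Q = P * pderiv Q"
  shows "degree Q = 0"
proof (rule ccontr)
  assume deg: "degree Q \<noteq> 0"
  then obtain z where z: "poly Q z = 0"
    using fundamental_theorem_of_algebra[of Q] by (auto simp: constant_degree)
  then have Pz: "poly P z \<noteq> 0" using nz by blast
  have Q': "pderiv Q \<noteq> 0" using deg by (simp add: pderiv_eq_0_iff)
  have ne: "P * pderiv Q \<noteq> 0" using Pz Q' by auto
  have "Q \<noteq> 0" using deg by auto
  then have "order z Q = Suc (order z (pderiv Q))" using z by (rule order_pderiv)
  moreover have "order z (pderiv P) + order z Q = order z P + order z (pderiv Q)"
    using ne W by (metis order_mult)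
  moreover have "order z P = 0" using Pz by (rule order_0I)
  ultimately show False by simp
qed

text \<open>The Wronskian is the numerator of the derivative of \<open>P / Q\<close>; its zeros
  contain the finite critical points away from poles.\<close>

lemma wronskian_nonzero:
  fixes P Q :: "complex poly"
  assumes "coprime P Q" "max (degree P) (degree Q) > 0"
  shows "pderiv P * Q - P * pderiv Q \<noteq> 0"
proof
  assume "pderiv P * Q - P * pderiv Q = 0"
  then have W: "pderiv P * Q = P * pderiv Q" by simp
  have nz: "poly P z \<noteq> 0 \<or> poly Q z \<noteq> 0" for z by (rule coprime_poly_nonzero[OF assms(1)])
  have "degree Q = 0" by (rule degree_0_if_wronskian_0[OF nz W])
  moreover have "degree P = 0"
    using nz W by (intro degree_0_if_wronskian_0[of Q P]) (auto simp: mult.commute)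
  ultimately show False using assms(2) by simp
qed

text \<open>A point \<open>z\<close> that is neither critical nor a preimage of \<open>\<infinity>\<close> or of the value at \<open>\<infinity>\<close> is a
  simple root of \<open>P - c Q\<close>, which has full degree; any other root is a second preimage of \<open>c\<close>.\<close>

lemma degree_one_if_unique_preimages:
  assumes PQ: "coprime P Q" and nonconst: "\<not> ratio_map P Q constant_on UNIV"
    and S: "open S" "S \<noteq> {}"
    and uniq: "\<And>x y. ratio_map P Q x = ratio_map P Q y \<Longrightarrow> ratio_map P Q x \<in> S \<Longrightarrow> x = y"
  shows "max (degree P) (degree Q) = 1"
proof -
  define f d where "f = ratio_map P Q" and "d = max (degree P) (degree Q)"
  have rat: "rational_map f" using PQ by (auto simp: rational_map_def f_def)
  have d: "d > 0" unfolding d_def by (rule ratio_map_degree_pos[OF nonconst])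
  define W where "W = pderiv P * Q - P * pderiv Q"
  have W: "W \<noteq> 0" using wronskian_nonzero PQ d by (simp add: W_def d_def)
  \<comment> \<open>The roots of \<open>R\<close> are the points where \<open>P / Q\<close> takes
    its value at \<open>Infty\<close>. If \<open>R\<close> vanished identically, \<open>P\<close>
    and \<open>Q\<close> would be proportional and \<open>W\<close> would be zero.\<close>
  define R where "R = smult (coeff Q d) P - smult (coeff P d) Q"
  have Q0: "Q \<noteq> 0" using W by (auto simp: W_def)
  have R: "R \<noteq> 0"
  proof
    assume "R = 0"
    then have R: "smult (coeff Q d) P = smult (coeff P d) Q" by (simp add: R_def)
    then have "smult (coeff Q d) (pderiv P) = smult (coeff P d) (pderiv Q)" by (metis pderiv_smult)
    then have "smult (coeff Q d) W = 0 \<and> smult (coeff P d) W = 0"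
      using R by (simp add: W_def smult_diff_right)
        (metis mult_smult_left mult_smult_right cancel_comm_monoid_add_class.diff_cancel mult.commute)
    then show False using W coprime_leading[OF PQ d_def] by auto
  qed
  have "open (f -` S)" by (rule open_vimage[OF S(1) rational_map_continuous_on[OF rat]])
  moreover have "f -` S \<noteq> {}"
  proof -
    obtain x where "x \<in> S" using S by blast
    moreover have "surj f" using rational_map_surj[OF rat] nonconst f_def by simp
    ultimately show ?thesis by (metis empty_iff surjD vimageI)
  qed
  moreover have "finite {z. poly (W * R * Q) z = 0}" using W R Q0 by (intro poly_roots_finite) auto
  ultimately obtain z where z: "Fin z \<in> f -` S" "z \<notin> {z. poly (W * R * Q) z = 0}"
    by (rule open_avoids_finite)
  then have nz: "poly W z \<noteq> 0" "poly R z \<noteq> 0" "poly Q z \<noteq> 0" by auto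
  define c where "c = poly P z / poly Q z"
  have Pz: "poly P z = c * poly Q z" using nz by (simp add: c_def)
  define T where "T = P - smult c Q"
  have "coeff T d \<noteq> 0"
  proof
    assume "coeff T d = 0"
    then have "coeff P d = c * coeff Q d" by (simp add: T_def)
    then show False using nz Pz by (simp add: R_def)
  qed
  then have dT: "degree T \<ge> d" by (rule le_degree)
  have "poly T z = 0" by (simp add: T_def Pz)
  then obtain A where A: "T = [:- z, 1:] * A" by (auto simp: poly_eq_0_iff_dvd dvd_def)
  have "A \<noteq> 0" using A dT d by auto
  then have dA: "degree T = Suc (degree A)" unfolding A by (subst degree_mult_eq) auto
  have "d = 1"
  proof (rule ccontr)
    assume "d \<noteq> 1"
    then have "degree A \<noteq> 0" using dA dT d by simp
    then obtain y where y: "poly A y = 0"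
      using fundamental_theorem_of_algebra[of A] by (auto simp: constant_degree)
    show False
    proof (cases "y = z")
      case True
      have "pderiv T = A + [:- z, 1:] * pderiv A" 
        unfolding A pderiv_mult by (simp add: pderiv_pCons)
      then have "poly (pderiv T) z = 0" using y True by simp
      then have "poly (pderiv P) z = c * poly (pderiv Q) z" by (simp add: T_def pderiv_diff pderiv_smult)
      then show False using nz(1) Pz by (simp add: W_def)
    next
      case False
      have "poly T y = 0" using y A by simp
      then have Py: "poly P y = c * poly Q y" by (simp add: T_def)
      then have "poly Q y \<noteq> 0" using coprime_poly_nonzero[OF PQ, of y] by auto
      then have "f (Fin y) = f (Fin z)" using Py Pz nz by (simp add: f_def)
      then show False using uniq[of "Fin z" "Fin y"] z(1) False by (simp add: f_def)
    qed
  qed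
  then show ?thesis by (simp add: d_def)
qed

lemma moebius_if_unique_preimages:
  assumes rat: "rational_map f" and nonconst: "\<not> f constant_on UNIV"
    and S: "open S" "S \<noteq> {}"
    and uniq: "\<And>x y. f x = f y \<Longrightarrow> f x \<in> S \<Longrightarrow> x = y"
  shows "moebius f"
proof -
  obtain P Q where PQ: "coprime P Q" "f = ratio_map P Q" using rat by (auto simp: rational_map_def)
  have deg: "max (degree P) (degree Q) = 1"
    using degree_one_if_unique_preimages[OF PQ(1) _ S] nonconst uniq PQ(2) by blast
  have linear: "R = [:coeff R 0, coeff R 1:]" if "degree R \<le> 1" for R :: "complex poly"
  proof (rule poly_eqI)
    fix n
    show "coeff R n = coeff [:coeff R 0, coeff R 1:] n"
      using that by (cases "n \<le> 1") (auto simp: le_Suc_eq coeff_eq_0 coeff_pCons split: nat.split)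
  qed
  obtain a b c d where P: "P = [:b, a:]" and Q: "Q = [:d, c:]"
    using linear[of P] linear[of Q] deg by (metis max.cobounded1 max.cobounded2)
  \<comment> \<open>For polynomials of degree at most one the Wronskian is the determinant.\<close>
  have "pderiv P * Q - P * pderiv Q \<noteq> 0" using wronskian_nonzero[OF PQ(1)] deg by simp
  then have "a * d - b * c \<noteq> 0" by (auto simp: P Q pderiv_pCons algebra_simps)
  then show ?thesis unfolding moebius_def PQ(2) P Q by blast
qed

context osc_semigroup
begin

lemma exists_wandering:
  assumes "m = 1 \<Longrightarrow> h 1 \<noteq> id \<and> \<not> elliptic (h 1)" "Julia G \<noteq> closure U"
  obtains V where "open V" "V \<noteq> {}" "V \<subseteq> \<Omega>" "\<And>g y. g \<in> G \<Longrightarrow> y \<in> V \<Longrightarrow> g y \<notin> V"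
proof (rule wandering_or_recurrent)
  assume rec: recurrent
  have \<Omega>: "\<Omega> \<noteq> {}" by (rule \<Omega>_nonempty[OF assms(2)])
  have m: "m = 1" by (rule recurrent_one_generator[OF rec \<Omega>])
  then have one: "1 \<in> {1..m}" by simp
  have uniq: "x = y" if "h 1 x = h 1 y" "h 1 x \<in> \<Omega>" for x y
    using recurrent_preimage_unique[OF rec one one refl, of y x] that by simp
  have "moebius (h 1)"
    using moebius_if_unique_preimages[OF rational_G nonconstant_G open_\<Omega> \<Omega> uniq] generator_in_G[OF one] by blast
  then obtain x e where x: "x \<in> \<Omega>" "e > 0" "\<And>n. n \<ge> 1 \<Longrightarrow> dist ((h 1 ^^ n) x) x \<ge> e"
    using moebius_not_recurrent[OF _ _ _ open_\<Omega> \<Omega>] assms(1)[OF m] by blast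
  then obtain w where w: "w \<noteq> []" "set w \<subseteq> {1..m}" "dist (word w x) x < e"
    using rec unfolding recurrent_def by blast
  \<comment> \<open>With one generator every word is an iterate, so recurrence contradicts the
    uniform distance \<open>e\<close>.\<close>
  have "word w = h 1 ^^ length w" if "set w \<subseteq> {1..m}" for w
    using that m by (induction w) (auto simp: funpow_Suc_right simp del: funpow.simps)
  then show thesis using w x(3)[of "length w"] by (auto simp: Suc_le_eq)
qed (rule that)

end

section \<open>Area\<close>

text \<open>Disjoint Vitali balls inside \<open>T\<close> cover \<open>E\<close> up to a null set,
  whose image is again null. The image of the centre and the Lipschitz bound place the image of each
  ball in a ball with radius multiplied by \<open>L\<close>.\<close>

lemma emeasure_Lipschitz_image_le_open:
  fixes f :: "'a::euclidean_space \<Rightarrow> 'a"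
  assumes L: "L > 0" and Lip: "\<And>x y. x \<in> T \<Longrightarrow> y \<in> T \<Longrightarrow> norm (f x - f y) \<le> L * norm (x - y)"
    and T: "open T" and E: "E \<subseteq> T" and fE: "f ` E \<in> sets borel"
  shows "emeasure lborel (f ` E) \<le> ennreal (L ^ DIM('a)) * emeasure lborel T"
proof -
  define K :: "('a \<times> real) set" where "K = {(a, r). r > 0 \<and> ball a r \<subseteq> T}"
  obtain C where C: "countable C" "C \<subseteq> K"
    and disj: "pairwise (\<lambda>i j. disjnt (ball (fst i) (snd i)) (ball (fst j) (snd j))) C"
    and neg: "negligible (E - (\<Union>i\<in>C. ball (fst i) (snd i)))"
  proof (rule Vitali_covering_theorem_balls[of E K fst snd])
    fix x d assume x: "x \<in> E" and d: "0 < (d::real)"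
    then obtain r where r: "r > 0" "ball x r \<subseteq> T" using T E open_contains_ball by blast
    then have "ball x (min r (d / 2)) \<subseteq> T" by (meson min.cobounded1 order_trans subset_ball)
    then show "\<exists>i. i \<in> K \<and> x \<in> ball (fst i) (snd i) \<and> snd i < d"
      using r(1) d by (intro exI[of _ "(x, min r (d / 2))"]) (auto simp: K_def)
  qed
  define c where "c n = from_nat_into C n" for n
  define N where "N = to_nat_on C ` C"
  have cN: "c n \<in> C" if "n \<in> N" for n
    using that C(1) by (auto simp: c_def N_def)
  have cov: "\<exists>n\<in>N. c n = i" if "i \<in> C" for i
    using that C(1) by (intro bexI[of _ "to_nat_on C i"]) (auto simp: c_def N_def)
  define D where "D n = (if n \<in> N then ball (fst (c n)) (snd (c n)) else {})" for n
  define D' where "D' n = (if n \<in> N then cball (f (fst (c n))) (L * snd (c n)) else {})" for n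
  have cK: "snd (c n) > 0" "ball (fst (c n)) (snd (c n)) \<subseteq> T" if "n \<in> N" for n
    using subsetD[OF C(2) cN[OF that]] by (simp_all add: K_def case_prod_beta)
  have vol: "emeasure lborel (D' n) = ennreal (L ^ DIM('a)) * emeasure lborel (D n)" for n
    using cK(1)[of n] L
    by (auto simp: D_def D'_def emeasure_ball emeasure_cball power_mult_distrib mult.left_commute
        simp flip: ennreal_mult')
  have "disjoint_family D"
    unfolding disjoint_family_on_def
  proof (intro ballI impI)
    fix n k :: nat assume nk: "n \<noteq> k"
    show "D n \<inter> D k = {}"
    proof (cases "n \<in> N \<and> k \<in> N")
      case True
      then have "c n \<noteq> c k"
        using nk C(1) by (auto simp: c_def N_def)
      then have "disjnt (ball (fst (c n)) (snd (c n))) (ball (fst (c k)) (snd (c k)))"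
        using disj cN True by (auto simp: pairwise_def)
      then show ?thesis using True by (simp add: D_def disjnt_def)
    qed (auto simp: D_def)
  qed
  then have sumD: "(\<Sum>n. emeasure lborel (D n)) = emeasure lborel (\<Union>n. D n)"
    by (rule suminf_emeasure[rotated]) (auto simp: D_def)
  have "(\<Union>n. D n) \<subseteq> T" using cK(2) by (auto simp: D_def split: if_splits)
  then have UD: "emeasure lborel (\<Union>n. D n) \<le> emeasure lborel T"
    by (rule emeasure_mono) (use T in auto)
  define Z where "Z = f ` (E - (\<Union>i\<in>C. ball (fst i) (snd i)))"
  have "negligible Z"
    unfolding Z_def
  proof (rule negligible_locally_Lipschitz_image[OF order_refl neg])
    fix x assume "x \<in> E - (\<Union>i\<in>C. ball (fst i) (snd i))"
    then show "\<exists>T' B. open T' \<and> x \<in> T' \<and>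
        (\<forall>y\<in>(E - (\<Union>i\<in>C. ball (fst i) (snd i))) \<inter> T'. norm (f y - f x) \<le> B * norm (y - x))"
      using E T Lip by (intro exI[of _ T] exI[of _ L]) auto
  qed
  then have Z: "Z \<in> null_sets lebesgue" by (simp add: negligible_iff_null_sets)
  have "f ` E \<subseteq> Z \<union> (\<Union>n. D' n)"
  proof
    fix y assume "y \<in> f ` E"
    then obtain x where x: "x \<in> E" "y = f x" by blast
    show "y \<in> Z \<union> (\<Union>n. D' n)"
    proof (cases "x \<in> (\<Union>i\<in>C. ball (fst i) (snd i))")
      case True
      then obtain n where n: "n \<in> N" "x \<in> ball (fst (c n)) (snd (c n))" using cov by blast
      have "fst (c n) \<in> T" "x \<in> T" using cK[OF n(1)] x E by auto
      then have "norm (f (fst (c n)) - f x) \<le> L * norm (fst (c n) - x)" by (rule Lip)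
      also have "\<dots> \<le> L * snd (c n)" using n(2) L by (simp add: dist_norm)
      finally have "y \<in> D' n" using n(1) x by (simp add: D'_def dist_norm)
      then show ?thesis by blast
    qed (use x in \<open>auto simp: Z_def\<close>)
  qed
  then have "emeasure lebesgue (f ` E) \<le> emeasure lebesgue (Z \<union> (\<Union>n. D' n))"
    using Z by (intro emeasure_mono sets.Un) (auto simp: D'_def)
  also have "\<dots> \<le> emeasure lebesgue Z + emeasure lebesgue (\<Union>n. D' n)"
    using Z by (intro emeasure_subadditive) (auto simp: D'_def)
  also have "\<dots> = emeasure lborel (\<Union>n. D' n)"
    using Z by (subst emeasure_completion) (auto simp: null_setsD1 D'_def intro!: sets.countable_UN)
  also have "\<dots> \<le> (\<Sum>n. emeasure lborel (D' n))"
    by (intro emeasure_subadditive_countably) (auto simp: D'_def)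
  also have "\<dots> = ennreal (L ^ DIM('a)) * (\<Sum>n. emeasure lborel (D n))"
    by (simp add: vol)
  also have "\<dots> \<le> ennreal (L ^ DIM('a)) * emeasure lborel T"
    unfolding sumD by (intro mult_left_mono UD) simp
  finally show ?thesis using fE by simp
qed

text \<open>Outer regularity shrinks the open superset \<open>T\<close> to \<open>E\<close>; an
  excess below \<open>e / M\<close> costs at most \<open>e\<close> after multiplication by
  \<open>M\<close>.\<close>

lemma emeasure_Lipschitz_image_le:
  fixes f :: "'a::euclidean_space \<Rightarrow> 'a"
  assumes L: "L > 0" and Lip: "\<And>x y. x \<in> B \<Longrightarrow> y \<in> B \<Longrightarrow> norm (f x - f y) \<le> L * norm (x - y)"
    and B: "open B" and E: "E \<subseteq> B" "E \<in> sets borel" and fE: "f ` E \<in> sets borel"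
  shows "emeasure lborel (f ` E) \<le> ennreal (L ^ DIM('a)) * emeasure lborel E"
proof (cases "emeasure lborel E = \<infinity>")
  case True
  then show ?thesis using L by (simp add: ennreal_mult_top)
next
  case False
  define M where "M = L ^ DIM('a)"
  have M: "M > 0" using L by (simp add: M_def)
  show ?thesis
    unfolding M_def[symmetric]
  proof (rule ennreal_le_epsilon)
    fix e :: real assume e: "e > 0"
    then have "e / M > 0" using M by simp
    then obtain T where T: "open T" "E \<subseteq> T" "emeasure lborel (T - E) < ennreal (e / M)"
      using outer_regular_lborel[OF E(2)] by blast
    have "emeasure lborel (f ` E) \<le> ennreal M * emeasure lborel (T \<inter> B)"
      unfolding M_def
      by (rule emeasure_Lipschitz_image_le_open[OF L Lip _ _ fE]) (use T E B in auto)
    also have "emeasure lborel (T \<inter> B) \<le> emeasure lborel (E \<union> (T - E))"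
      using T(1) E(2) by (intro emeasure_mono) auto
    also have "\<dots> \<le> emeasure lborel E + emeasure lborel (T - E)"
      using T(1) E(2) by (intro emeasure_subadditive) auto
    also have "\<dots> \<le> emeasure lborel E + ennreal (e / M)"
      using T(3) by (intro add_left_mono) auto
    finally have "emeasure lborel (f ` E) \<le> ennreal M * (emeasure lborel E + ennreal (e / M))"
      by (simp add: mult_left_mono)
    also have "\<dots> = ennreal M * emeasure lborel E + ennreal e"
      using M e by (simp add: distrib_left flip: ennreal_mult')
    finally show "emeasure lborel (f ` E) \<le> ennreal M * emeasure lborel E + ennreal e" .
  qed
qed

section \<open>Spherical area in the affine coordinate\<close>

lemma le_suminf_ennreal: "f k \<le> (\<Sum>n. f n)" for f :: "nat \<Rightarrow> ennreal"
  using sum_le_suminf[OF summableI, of "{k}" f] by simp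

text \<open>The factor \<open>4\<close> of \<open>sphere_measure\<close> is dropped, as only
  finiteness and null sets matter.\<close>

definition spherical_density :: "complex \<Rightarrow> real" where
  "spherical_density y = 1 / (1 + (cmod y)\<^sup>2)\<^sup>2"

lemma borel_measurable_spherical_density [measurable]: "spherical_density \<in> borel_measurable borel"
  unfolding spherical_density_def by measurable

text \<open>Where \<open>cmod y\<close> lies between \<open>2 ^ k\<close> and
  \<open>2 ^ (k + 1)\<close> the density is at most \<open>(1 / 16) ^ k\<close>, while the disc has
  area proportional to \<open>4 ^ k\<close>. This leaves a geometric series of ratio
  \<open>1 / 4\<close>.\<close>

lemma spherical_density_finite: "(\<integral>\<^sup>+ y. ennreal (spherical_density y) \<partial>lborel) < \<infinity>"
proof -
  define V where "V = unit_ball_vol 2"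
  have V: "V \<ge> 0" by (simp add: V_def)
  have le: "ennreal (spherical_density y) \<le> (\<Sum>k. ennreal ((1 / 16) ^ k) * indicator (ball 0 (2 ^ (k + 1))) y)" for y
  proof -
    define k where "k = (LEAST k. cmod y < 2 ^ (k + 1))"
    obtain n :: nat where "cmod y < 2 ^ n" using real_arch_pow[of 2 "cmod y"] by auto
    then have "cmod y < 2 ^ (n + 1)" by (simp add: less_le_trans)
    then have k1: "cmod y < 2 ^ (k + 1)" unfolding k_def by (rule LeastI)
    have "(1 + (cmod y)\<^sup>2)\<^sup>2 \<ge> 16 ^ k"
    proof (cases "k = 0")
      case False
      then obtain i where i: "k = Suc i" by (cases k) auto
      have "\<not> cmod y < 2 ^ (i + 1)" using not_less_Least[of i "\<lambda>k. cmod y < 2 ^ (k + 1)"] i by (simp add: k_def)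
      then have "cmod y \<ge> 2 ^ k" using i by simp
      then have "(cmod y) ^ 2 \<ge> (2 ^ k) ^ 2" by (intro power_mono) auto
      then have "1 + (cmod y)\<^sup>2 \<ge> 4 ^ k" by (simp flip: power_mult power_mult_distrib add: power_mult mult.commute[of k])
      then have "(1 + (cmod y)\<^sup>2)\<^sup>2 \<ge> (4 ^ k)\<^sup>2" by (intro power_mono) auto
      also have "((4::real) ^ k)\<^sup>2 = 16 ^ k" by (simp add: power2_eq_square flip: power_mult_distrib)
      finally show ?thesis .
    qed simp
    then have "spherical_density y \<le> (1 / 16) ^ k"
      unfolding spherical_density_def power_one_over
      by (intro divide_left_mono mult_pos_pos zero_less_power add_pos_nonneg) auto
    then have "ennreal (spherical_density y) \<le> ennreal ((1 / 16) ^ k) * indicator (ball 0 (2 ^ (k + 1))) y"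
      using k1 by (simp add: ennreal_leI)
    also have "\<dots> \<le> (\<Sum>k. ennreal ((1 / 16) ^ k) * indicator (ball 0 (2 ^ (k + 1))) y)"
      by (rule le_suminf_ennreal)
    finally show ?thesis .
  qed
  have "(\<integral>\<^sup>+ y. ennreal (spherical_density y) \<partial>lborel)
      \<le> (\<integral>\<^sup>+ y. (\<Sum>k. ennreal ((1 / 16) ^ k) * indicator (ball (0::complex) (2 ^ (k + 1))) y) \<partial>lborel)"
    by (intro nn_integral_mono le)
  also have "\<dots> = (\<Sum>k. \<integral>\<^sup>+ y. ennreal ((1 / 16) ^ k) * indicator (ball (0::complex) (2 ^ (k + 1))) y \<partial>lborel)"
    by (intro nn_integral_suminf borel_measurable_times_ennreal borel_measurable_const borel_measurable_indicator) simp
  also have "\<dots> = (\<Sum>k. ennreal ((1 / 16) ^ k) * emeasure lborel (ball (0::complex) (2 ^ (k + 1))))"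
    by (intro suminf_cong nn_integral_cmult_indicator) simp
  also have "\<dots> = (\<Sum>k. ennreal (V * 4 * (1 / 4) ^ k))"
  proof (intro suminf_cong)
    fix k
    have "(1 / 16) ^ k * (V * (2 ^ (k + 1)) ^ 2) = V * 4 * ((1 / 16) ^ k * ((2::real) ^ k) ^ 2)"
      by (simp add: power2_eq_square)
    also have "(1 / 16) ^ k * ((2::real) ^ k) ^ 2 = (1 / 16) ^ k * 4 ^ k" by (simp add: power2_eq_square flip: power_mult_distrib)
    also have "\<dots> = (1 / 4) ^ k" by (simp flip: power_mult_distrib)
    finally have "(1 / 16) ^ k * (V * (2 ^ (k + 1)) ^ 2) = V * 4 * (1 / 4) ^ k" .
    then show "ennreal ((1 / 16) ^ k) * emeasure lborel (ball (0::complex) (2 ^ (k + 1))) = ennreal (V * 4 * (1 / 4) ^ k)"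
      by (subst emeasure_ball) (simp_all add: V_def[symmetric] V flip: ennreal_mult')
  qed
  also have "\<dots> = ennreal (\<Sum>k. V * 4 * (1 / 4) ^ k)"
    using V by (intro suminf_ennreal2 summable_mult summable_geometric) auto
  finally show ?thesis by (simp add: less_top le_less_trans)
qed

definition spherical_area :: "complex measure" where
  "spherical_area = density lborel (\<lambda>y. ennreal (spherical_density y))"

lemma sets_spherical_area [measurable_cong, simp]: "sets spherical_area = sets borel"
  by (simp add: spherical_area_def)

lemma emeasure_spherical_area_finite: "emeasure spherical_area A < \<infinity>"
proof -
  have "emeasure spherical_area A \<le> emeasure spherical_area UNIV"
    by (intro emeasure_mono) auto
  also have "\<dots> = (\<integral>\<^sup>+ y. ennreal (spherical_density y) \<partial>lborel)"
    by (simp add: spherical_area_def emeasure_density)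
  finally show ?thesis using spherical_density_finite by (rule le_less_trans)
qed

text \<open>Balls on which \<open>f\<close> is injective and both \<open>|f'|\<close> and \<open>1 + |y|\<^sup>2\<close> are constant up to a factor
  of two. On such a ball the change of variables formula holds up to a constant because \<open>f\<close> is
  Lipschitz there.\<close>

definition tame_ball :: "(complex \<Rightarrow> complex) \<Rightarrow> complex set \<Rightarrow> real \<Rightarrow> real \<Rightarrow> complex set \<Rightarrow> bool" where
  "tame_ball f E a b B \<longleftrightarrow> a > 0 \<and> b > 0 \<and> (\<exists>y r. B = ball y r) \<and> B \<subseteq> E \<and> inj_on f B \<and>
     (\<forall>y\<in>B. a / 2 \<le> cmod (deriv f y) \<and> cmod (deriv f y) \<le> 2 * a \<and>
            b / 2 \<le> 1 + (cmod y)\<^sup>2 \<and> 1 + (cmod y)\<^sup>2 \<le> 2 * b)"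

lemma tame_ball_exists:
  assumes E: "open E" "f holomorphic_on E" "y \<in> E" and nz: "deriv f y \<noteq> 0"
  shows "\<exists>a b B. tame_ball f E a b B \<and> y \<in> B"
proof -
  define a b where "a = cmod (deriv f y)" and "b = 1 + (cmod y)\<^sup>2"
  have ab: "a > 0" "b > 0" using nz by (auto simp: a_def b_def add_pos_nonneg)
  obtain r where r: "r > 0" "ball y r \<subseteq> E" "inj_on f (ball y r)"
    using has_complex_derivative_locally_injective[OF E(2,3,1) nz] by blast
  have "deriv f holomorphic_on E" using E by (intro holomorphic_deriv)
  then have "isCont (deriv f) y"
    using E by (meson holomorphic_on_imp_continuous_on continuous_on_eq_continuous_at)
  then have "isCont (\<lambda>z. cmod (deriv f z)) y" by (rule continuous_norm)
  then have l1: "((\<lambda>z. cmod (deriv f z)) \<longlongrightarrow> a) (nhds y)"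
    using tendsto_at_iff_tendsto_nhds[of "\<lambda>z. cmod (deriv f z)" y] by (simp only: a_def isCont_def)
  have "isCont (\<lambda>z. 1 + (cmod z)\<^sup>2) y" by (intro continuous_intros)
  then have l2: "((\<lambda>z. 1 + (cmod z)\<^sup>2) \<longlongrightarrow> b) (nhds y)"
    using tendsto_at_iff_tendsto_nhds[of "\<lambda>z. 1 + (cmod z)\<^sup>2" y] by (simp only: b_def isCont_def)
  have "\<forall>\<^sub>F z in nhds y. (a / 2 < cmod (deriv f z) \<and> cmod (deriv f z) < 2 * a) \<and>
      (b / 2 < 1 + (cmod z)\<^sup>2 \<and> 1 + (cmod z)\<^sup>2 < 2 * b)"
    using ab by (intro eventually_conj order_tendstoD[OF l1] order_tendstoD[OF l2]) auto
  then obtain d where d: "d > 0" "\<And>z. dist z y < d \<Longrightarrow> (a / 2 < cmod (deriv f z) \<and> cmod (deriv f z) < 2 * a) \<and>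
      (b / 2 < 1 + (cmod z)\<^sup>2 \<and> 1 + (cmod z)\<^sup>2 < 2 * b)"
    unfolding eventually_nhds_metric by blast
  have sub: "ball y (min r d) \<subseteq> ball y r" by (rule subset_ball) simp
  have "tame_ball f E a b (ball y (min r d))"
    unfolding tame_ball_def
  proof (intro conjI ballI)
    fix z assume "z \<in> ball y (min r d)"
    then have "dist z y < d" by (simp add: dist_commute)
    note z = d(2)[OF this]
    show "a / 2 \<le> cmod (deriv f z)" "cmod (deriv f z) \<le> 2 * a"
      "b / 2 \<le> 1 + (cmod z)\<^sup>2" "1 + (cmod z)\<^sup>2 \<le> 2 * b"
      using z by simp_all
  qed (use ab r sub in \<open>auto intro: inj_on_subset\<close>)
  moreover have "y \<in> ball y (min r d)" using r(1) d(1) by simp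
  ultimately show ?thesis by blast
qed

text \<open>If \<open>k\<close> bounds \<open>1 + (cmod x)\<^sup>2\<close> on the image,
  \<open>4 * k / (a * b)\<close> bounds the inverse spherical derivative on \<open>B\<close>. In
  \<open>256 = 16 * 4 * 4\<close> the factors come from its square, from the Lipschitz constant
  \<open>2 * a\<close>, and from comparing \<open>b\<close> with
  \<open>1 + (cmod y)\<^sup>2\<close>.\<close>

lemma tame_ball_area:
  assumes tame: "tame_ball f E a b B" and E: "open E" "f holomorphic_on E"
    and A: "A \<subseteq> B" "A \<in> sets borel" "f ` A \<in> sets borel"
  shows "ennreal ((4 * k / (a * b))\<^sup>2) * emeasure lborel (f ` A) \<le> ennreal (256 * k\<^sup>2) * emeasure spherical_area A"
proof -
  have ab: "a > 0" "b > 0" and B: "\<exists>y r. B = ball y r" "B \<subseteq> E"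
    and bd: "\<And>y. y \<in> B \<Longrightarrow> cmod (deriv f y) \<le> 2 * a" "\<And>y. y \<in> B \<Longrightarrow> 1 + (cmod y)\<^sup>2 \<le> 2 * b"
    using tame by (auto simp: tame_ball_def)
  have oB: "open B" "convex B" using B by auto
  have "norm (f x - f y) \<le> (2 * a) * norm (x - y)" if "x \<in> B" "y \<in> B" for x y
  proof (rule field_differentiable_bound[OF oB(2) _ bd(1) that])
    fix z assume "z \<in> B"
    then have "(f has_field_derivative deriv f z) (at z)"
      using E B by (intro holomorphic_derivI[of f E]) auto
    then show "(f has_field_derivative deriv f z) (at z within B)"
      by (rule has_field_derivative_at_within)
  qed
  then have "emeasure lborel (f ` A) \<le> ennreal ((2 * a) ^ DIM(complex)) * emeasure lborel A"
    using ab by (intro emeasure_Lipschitz_image_le[of "2 * a" B]) (use oB A in auto)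
  then have "ennreal ((4 * k / (a * b))\<^sup>2) * emeasure lborel (f ` A)
      \<le> ennreal ((4 * k / (a * b))\<^sup>2) * (ennreal ((2 * a) ^ DIM(complex)) * emeasure lborel A)"
    by (rule mult_left_mono) simp
  also have "\<dots> = ennreal (64 * k\<^sup>2 / b\<^sup>2) * emeasure lborel A"
  proof -
    have "(4 * k / (a * b))\<^sup>2 * (2 * a)\<^sup>2 = 64 * k\<^sup>2 / b\<^sup>2"
      using ab by (simp add: power2_eq_square field_simps)
    then show ?thesis by (simp add: mult.assoc[symmetric] flip: ennreal_mult')
  qed
  also have "\<dots> = (\<integral>\<^sup>+ y. ennreal (64 * k\<^sup>2 / b\<^sup>2) * indicator A y \<partial>lborel)"
    using A(2) by (simp add: nn_integral_cmult_indicator)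
  also have "\<dots> \<le> (\<integral>\<^sup>+ y. ennreal (256 * k\<^sup>2) * (ennreal (spherical_density y) * indicator A y) \<partial>lborel)"
  proof (intro nn_integral_mono)
    fix y
    show "ennreal (64 * k\<^sup>2 / b\<^sup>2) * indicator A y
        \<le> ennreal (256 * k\<^sup>2) * (ennreal (spherical_density y) * indicator A y)"
    proof (cases "y \<in> A")
      case True
      have p: "1 + (cmod y)\<^sup>2 > 0" by (simp add: add_pos_nonneg)
      have "(1 + (cmod y)\<^sup>2)\<^sup>2 \<le> (2 * b)\<^sup>2" using bd(2) True A(1) p by (intro power_mono) auto
      then have "1 / (2 * b)\<^sup>2 \<le> spherical_density y"
        unfolding spherical_density_def using p by (intro divide_left_mono mult_pos_pos) (use ab in auto)
      then have "256 * k\<^sup>2 * (1 / (2 * b)\<^sup>2) \<le> 256 * k\<^sup>2 * spherical_density y"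
        by (intro mult_left_mono) auto
      then have "64 * k\<^sup>2 / b\<^sup>2 \<le> 256 * k\<^sup>2 * spherical_density y" by (simp add: power_mult_distrib)
      then show ?thesis using True by (simp add: ennreal_leI flip: ennreal_mult')
    qed simp
  qed
  also have "\<dots> = ennreal (256 * k\<^sup>2) * emeasure spherical_area A"
    using A(2) by (simp add: spherical_area_def emeasure_density nn_integral_cmult)
  finally show ?thesis .
qed

text \<open>An upper bound of the change of variables formula
  \<open>\<integral> (\<Sum>f y = x. \<parallel>f' y\<parallel>\<^sup>-\<^sup>2) dA(x) = A(E)\<close>, with multiplicative constants.\<close>

lemma fibre_sum_majorant:
  assumes E: "open E" "f holomorphic_on E" and nz: "\<And>y. y \<in> E \<Longrightarrow> deriv f y \<noteq> 0"
    and R: "\<And>y. y \<in> E \<Longrightarrow> 1 + (cmod (f y))\<^sup>2 \<le> k"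
  obtains H :: "complex \<Rightarrow> ennreal" where "H \<in> borel_measurable borel"
    "(\<integral>\<^sup>+ x. H x \<partial>lborel) \<le> ennreal (256 * k\<^sup>2) * emeasure spherical_area E"
    "\<And>x F. finite F \<Longrightarrow> F \<subseteq> {y \<in> E. f y = x} \<Longrightarrow>
       (\<Sum>y\<in>F. ennreal (((1 + (cmod x)\<^sup>2) / (cmod (deriv f y) * (1 + (cmod y)\<^sup>2)))\<^sup>2)) \<le> H x"
proof -
  define \<B> where "\<B> = {B. \<exists>a b. tame_ball f E a b B}"
  have "open B" if "B \<in> \<B>" for B using that by (auto simp: \<B>_def tame_ball_def)
  then obtain \<B>' where \<B>': "\<B>' \<subseteq> \<B>" "countable \<B>'" "\<Union>\<B>' = \<Union>\<B>" using Lindelof by metis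
  \<comment> \<open>The empty set is adjoined because enumeration by \<open>from_nat_into\<close>
    needs a nonempty family, while \<open>E\<close> may be empty.\<close>
  have "{} = ball (0::complex) 0" by simp
  then have "tame_ball f E 1 1 {}" unfolding tame_ball_def by (metis ball_empty empty_iff empty_subsetI inj_on_empty order_refl zero_less_one)
  then have \<B>'': "insert {} \<B>' \<subseteq> \<B>" using \<B>'(1) by (auto simp: \<B>_def)
  define B where "B = from_nat_into (insert {} \<B>')"
  have rB: "range B = insert {} \<B>'"
    unfolding B_def using \<B>'(2) by (intro range_from_nat_into) auto
  have "B i \<in> \<B>" for i
    using rangeI[of B i] unfolding rB by (rule subsetD[OF \<B>''])
  then have "\<forall>i. \<exists>a b. tame_ball f E a b (B i)" by (auto simp: \<B>_def)
  then obtain a b where tame: "\<And>i. tame_ball f E (a i) (b i) (B i)" by metis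
  have BE: "B i \<subseteq> E" and oB: "open (B i)" and inj: "inj_on f (B i)" for i
    using tame[of i] by (auto simp: tame_ball_def)
  have UB: "(\<Union>i. B i) = E"
  proof -
    have "E \<subseteq> \<Union>\<B>"
    proof
      fix y assume "y \<in> E"
      then show "y \<in> \<Union>\<B>" using tame_ball_exists[OF E _ nz] by (fastforce simp: \<B>_def)
    qed
    also have "\<Union>\<B> = (\<Union>i. B i)" using rB \<B>'(3) by auto
    finally show ?thesis using BE by blast
  qed
  define D where "D = disjointed B"
  have DB: "D i \<subseteq> B i" for i unfolding D_def by (rule disjointed_subset)
  have UD: "(\<Union>i. D i) = E" unfolding D_def UN_disjointed_eq UB ..
  have disj: "disjoint_family D" unfolding D_def by (rule disjoint_family_disjointed)
  have D_borel: "D i \<in> sets borel" for i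
    using oB by (auto simp: D_def disjointed_def intro!: sets.Diff sets.finite_UN)
  have fD_borel: "f ` D i \<in> sets borel" for i
  proof -
    \<comment> \<open>The image of the Borel set \<open>D i\<close> is Borel because injectivity on
      \<open>B i\<close> makes it a difference of two open images.\<close>
    define C where "C = B i \<inter> (\<Union>j\<in>{0..<i}. B j)"
    have C: "open C" "C \<subseteq> B i" using oB by (auto simp: C_def)
    have hol: "f holomorphic_on B i" using E(2) BE holomorphic_on_subset by blast
    have "D i = B i - C" by (auto simp: D_def disjointed_def C_def)
    then have "f ` D i = f ` B i - f ` C" using inj_on_image_set_diff[OF inj[of i] _ C(2)] by auto
    moreover have "open (f ` B i)" by (rule open_mapping_thm3[OF hol oB inj])
    moreover have "open (f ` C)"
      using hol C inj inj_on_subset holomorphic_on_subset by (intro open_mapping_thm3) blast+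
    ultimately show ?thesis by auto
  qed
  define c where "c i = (4 * k / (a i * b i))\<^sup>2" for i
  \<comment> \<open>Each piece contributes one constant on its image, since a fibre meets it at most
    once.\<close>
  define H where "H x = (\<Sum>i. ennreal (c i) * indicator (f ` D i) x)" for x
  show ?thesis
  proof (rule that[of H])
    show "H \<in> borel_measurable borel"
      unfolding H_def using fD_borel by measurable
    have "(\<integral>\<^sup>+ x. H x \<partial>lborel) = (\<Sum>i. ennreal (c i) * emeasure lborel (f ` D i))"
      unfolding H_def using fD_borel
      by (subst nn_integral_suminf) (auto simp: nn_integral_cmult_indicator)
    also have "\<dots> \<le> (\<Sum>i. ennreal (256 * k\<^sup>2) * emeasure spherical_area (D i))"
      unfolding c_def by (intro suminf_le tame_ball_area[OF tame E DB D_borel fD_borel]) auto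
    also have "\<dots> = ennreal (256 * k\<^sup>2) * (\<Sum>i. emeasure spherical_area (D i))"
      by simp
    also have "(\<Sum>i. emeasure spherical_area (D i)) = emeasure spherical_area E"
      unfolding UD[symmetric] by (rule suminf_emeasure) (use D_borel disj in auto)
    finally show "(\<integral>\<^sup>+ x. H x \<partial>lborel) \<le> ennreal (256 * k\<^sup>2) * emeasure spherical_area E" .
  next
    fix x and F :: "complex set" assume F: "finite F" "F \<subseteq> {y \<in> E. f y = x}"
    have "\<forall>y\<in>F. \<exists>i. y \<in> D i" using F(2) UD by blast
    then obtain n where n: "\<And>y. y \<in> F \<Longrightarrow> y \<in> D (n y)" by metis
    have inj_n: "inj_on n F"
    proof (rule inj_onI)
      fix y z assume yz: "y \<in> F" "z \<in> F" "n y = n z"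
      have "y \<in> B (n y)" using subsetD[OF DB n[OF yz(1)]] .
      moreover have "z \<in> B (n y)" using subsetD[OF DB n[OF yz(2)]] yz(3) by simp
      moreover have "f y = f z" using yz F(2) by auto
      ultimately show "y = z" using inj by (meson inj_onD)
    qed
    have "(\<Sum>y\<in>F. ennreal (((1 + (cmod x)\<^sup>2) / (cmod (deriv f y) * (1 + (cmod y)\<^sup>2)))\<^sup>2))
        \<le> (\<Sum>y\<in>F. ennreal (c (n y)) * indicator (f ` D (n y)) x)"
    proof (rule sum_mono)
      fix y assume y: "y \<in> F"
      have yB: "y \<in> B (n y)" using subsetD[OF DB n[OF y]] .
      have fy: "f y = x" "y \<in> E" using y F(2) by auto
      define A B' where "A = a (n y)" and "B' = b (n y)"
      have AB: "A > 0" "B' > 0" "A / 2 \<le> cmod (deriv f y)" "B' / 2 \<le> 1 + (cmod y)\<^sup>2"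
        using tame[of "n y"] yB by (auto simp: tame_ball_def A_def B'_def)
      have "A / 2 * (B' / 2) \<le> cmod (deriv f y) * (1 + (cmod y)\<^sup>2)"
        using AB by (intro mult_mono) auto
      moreover have "A / 2 * (B' / 2) > 0" using AB by simp
      ultimately have "(1 + (cmod x)\<^sup>2) / (cmod (deriv f y) * (1 + (cmod y)\<^sup>2)) \<le> k / (A / 2 * (B' / 2))"
        using R[OF fy(2)] fy(1) by (intro frac_le) (auto intro: order_trans[of _ "1 + (cmod x)\<^sup>2"])
      then have "((1 + (cmod x)\<^sup>2) / (cmod (deriv f y) * (1 + (cmod y)\<^sup>2)))\<^sup>2 \<le> (k / (A / 2 * (B' / 2)))\<^sup>2"
        by (intro power_mono) (auto intro!: divide_nonneg_nonneg mult_nonneg_nonneg)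
      also have "k / (A / 2 * (B' / 2)) = 4 * k / (A * B')" by simp
      finally have "((1 + (cmod x)\<^sup>2) / (cmod (deriv f y) * (1 + (cmod y)\<^sup>2)))\<^sup>2 \<le> c (n y)"
        by (simp add: c_def A_def B'_def)
      moreover have "x \<in> f ` D (n y)" using n[OF y] fy by blast
      ultimately show "ennreal (((1 + (cmod x)\<^sup>2) / (cmod (deriv f y) * (1 + (cmod y)\<^sup>2)))\<^sup>2)
          \<le> ennreal (c (n y)) * indicator (f ` D (n y)) x"
        by (simp add: ennreal_leI)
    qed
    also have "\<dots> = (\<Sum>i\<in>n ` F. ennreal (c i) * indicator (f ` D i) x)"
      by (simp add: sum.reindex[OF inj_n])
    also have "\<dots> \<le> H x"
      unfolding H_def using F(1) by (intro sum_le_suminf) auto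
    finally show "(\<Sum>y\<in>F. ennreal (((1 + (cmod x)\<^sup>2) / (cmod (deriv f y) * (1 + (cmod y)\<^sup>2)))\<^sup>2)) \<le> H x" .
  qed
qed

section \<open>The Poincare series in the affine coordinate\<close>

text \<open>The identity holds at the poles as well: the chart at a finite value reads
  \<open>Infty\<close> as zero, which agrees with division by zero.\<close>

lemma local_rep_ratio_map:
  assumes "ratio_map P Q (Fin z) = Fin x"
  shows "local_rep (ratio_map P Q) (Fin z) = (\<lambda>w. poly P w / poly Q w)"
  using assms by (auto simp: local_rep_def fun_eq_iff)

lemma multiplicity_at_ratio_map:
  assumes x: "ratio_map P Q (Fin z) = Fin x" and nz: "deriv (\<lambda>w. poly P w / poly Q w) z \<noteq> 0"
  shows "multiplicity_at (ratio_map P Q) (Fin z) = 1"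
proof -
  define f where "f w = poly P w / poly Q w" for w
  have Qz: "poly Q z \<noteq> 0" using x by (auto split: if_splits)
  have op: "open (- {w. poly Q w = 0})"
    using Qz by (intro open_Compl finite_imp_closed poly_roots_finite) auto
  have hol: "f holomorphic_on - {w. poly Q w = 0}"
    unfolding f_def by (auto intro!: holomorphic_intros)
  have "(f has_field_derivative deriv f z) (at z)"
    using hol op Qz by (intro holomorphic_derivI) auto
  then have "deriv (\<lambda>w. f w - f z) z = deriv f z"
    by (intro DERIV_imp_deriv) (auto intro!: derivative_eq_intros)
  then have "zorder (\<lambda>w. f w - f z) z = 1"
    using nz Qz op hol
    by (intro zorder_zero_eqI[of _ "- {w. poly Q w = 0}"]) (auto simp: f_def[abs_def] intro!: holomorphic_intros)
  then show ?thesis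
    by (simp add: multiplicity_at_def local_rep_ratio_map[OF x] f_def)
qed

text \<open>Away from critical points the multiplicity is one and \<open>epowr\<close> is an
  ordinary power, which gives the summand of \<open>fibre_sum_majorant\<close>.\<close>

lemma poincare_term_ratio_map:
  assumes x: "ratio_map P Q (Fin z) = Fin x" and nz: "deriv (\<lambda>w. poly P w / poly Q w) z \<noteq> 0"
  shows "of_nat (multiplicity_at (ratio_map P Q) (Fin z)) * epowr (spherical_deriv (ratio_map P Q) (Fin z)) (- 2) =
    ennreal (((1 + (cmod x)\<^sup>2) / (cmod (deriv (\<lambda>w. poly P w / poly Q w) z) * (1 + (cmod z)\<^sup>2)))\<^sup>2)"
proof -
  define a where "a = cmod (deriv (\<lambda>w. poly P w / poly Q w) z)"
  have pos: "a > 0" "1 + (cmod x)\<^sup>2 > 0" "1 + (cmod z)\<^sup>2 > 0"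
    using nz by (auto simp: a_def add_pos_nonneg)
  have sd: "spherical_deriv (ratio_map P Q) (Fin z) = a * (1 + (cmod z)\<^sup>2) / (1 + (cmod x)\<^sup>2)"
    unfolding spherical_deriv_def local_rep_ratio_map[OF x] x by (simp add: a_def)
  define t where "t = a * (1 + (cmod z)\<^sup>2) / (1 + (cmod x)\<^sup>2)"
  have t: "t > 0" using pos by (simp add: t_def)
  have "t powr (- 2) = (inverse t)\<^sup>2"
    using t by (simp add: powr_minus powr_numeral power_inverse)
  also have "inverse t = (1 + (cmod x)\<^sup>2) / (a * (1 + (cmod z)\<^sup>2))" by (simp add: t_def)
  finally show ?thesis
    using t unfolding multiplicity_at_ratio_map[OF assms] sd t_def[symmetric] a_def[symmetric]
    by (simp add: epowr_def)
qed

lemma infsum_ennreal_le: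
  fixes f :: "'a \<Rightarrow> ennreal"
  assumes "\<And>F. finite F \<Longrightarrow> F \<subseteq> A \<Longrightarrow> sum f F \<le> c"
  shows "infsum f A \<le> c"
  by (subst nonneg_infsum_complete) (auto intro!: SUP_least assms)

text \<open>The exceptional values are the image of \<open>\<infinity>\<close> and the critical values.\<close>

lemma ratio_map_majorant:
  fixes P Q :: "complex poly" and g :: "riemann_sphere \<Rightarrow> riemann_sphere"
  assumes PQ: "coprime P Q" and g: "g = ratio_map P Q" and nonconst: "\<not> g constant_on UNIV"
    and D: "open D" "\<And>x. x \<in> D \<Longrightarrow> 1 + (cmod x)\<^sup>2 \<le> k"
  obtains H :: "complex \<Rightarrow> ennreal" and N where "H \<in> borel_measurable borel" "countable N"
    "(\<integral>\<^sup>+ x. H x \<partial>lborel) \<le> ennreal (256 * k\<^sup>2) * emeasure spherical_area (Fin -` g -` Fin ` D)"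
    "\<And>x. x \<in> D - N \<Longrightarrow>
       (\<Sum>\<^sub>\<infinity>y\<in>g -` {Fin x}. of_nat (multiplicity_at g y) * epowr (spherical_deriv g y) (- 2)) \<le> H x"
proof -
  define f where "f = (\<lambda>w. poly P w / poly Q w)"
  define E\<^sub>0 where "E\<^sub>0 = - {w. poly Q w = 0}"
  have W: "pderiv P * Q - P * pderiv Q \<noteq> 0"
    using wronskian_nonzero[OF PQ ratio_map_degree_pos] nonconst g by simp
  then have Q0: "Q \<noteq> 0" by auto
  have E0: "open E\<^sub>0" unfolding E\<^sub>0_def using Q0 by (intro open_Compl finite_imp_closed poly_roots_finite) auto
  have hol: "f holomorphic_on E\<^sub>0" unfolding f_def E\<^sub>0_def by (auto intro!: holomorphic_intros)
  have deriv_f: "deriv f w = poly (pderiv P * Q - P * pderiv Q) w / (poly Q w)\<^sup>2" if "w \<in> E\<^sub>0" for w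
    unfolding f_def
    by (intro DERIV_imp_deriv) (use that in \<open>auto simp: E\<^sub>0_def power2_eq_square intro!: derivative_eq_intros poly_DERIV\<close>)
  define C where "C = {w \<in> E\<^sub>0. deriv f w = 0}"
  have "C \<subseteq> {w. poly (pderiv P * Q - P * pderiv Q) w = 0}"
    using deriv_f by (auto simp: C_def E\<^sub>0_def)
  then have C: "finite C" using poly_roots_finite[OF W] finite_subset by blast
  define E where "E = {w \<in> E\<^sub>0. f w \<in> D} - C"
  have "open {w \<in> E\<^sub>0. f w \<in> D}"
    using continuous_open_preimage[OF holomorphic_on_imp_continuous_on[OF hol] E0 D(1)]
    by (simp add: vimage_def Int_def)
  then have E: "open E" unfolding E_def using C by (intro open_Diff finite_imp_closed)
  have EE0: "E \<subseteq> E\<^sub>0" by (auto simp: E_def)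
  obtain H :: "complex \<Rightarrow> ennreal" where H: "H \<in> borel_measurable borel"
    "(\<integral>\<^sup>+ x. H x \<partial>lborel) \<le> ennreal (256 * k\<^sup>2) * emeasure spherical_area E"
    "\<And>x F. finite F \<Longrightarrow> F \<subseteq> {y \<in> E. f y = x} \<Longrightarrow>
       (\<Sum>y\<in>F. ennreal (((1 + (cmod x)\<^sup>2) / (cmod (deriv f y) * (1 + (cmod y)\<^sup>2)))\<^sup>2)) \<le> H x"
  proof (rule fibre_sum_majorant[OF E holomorphic_on_subset[OF hol EE0]])
    show "deriv f y \<noteq> 0" "1 + (cmod (f y))\<^sup>2 \<le> k" if "y \<in> E" for y
      using that D(2) by (auto simp: E_def C_def)
  qed (use that in blast)
  define N where "N = {x. g Infty = Fin x} \<union> f ` C"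
  have "{x. g Infty = Fin x} \<subseteq> {finite_part (g Infty)}" by auto
  then have N: "countable N" using C by (auto simp: N_def intro: countable_finite finite_subset)
  have sub: "E \<subseteq> Fin -` g -` Fin ` D" by (auto simp: E_def E\<^sub>0_def g f_def)
  have rat: "rational_map g" using PQ g by (auto simp: rational_map_def)
  have "open (Fin -` g -` Fin ` D)"
    by (intro open_vimage_Fin open_vimage[OF _ rational_map_continuous_on[OF rat]] open_Fin_image D(1))
  then have "emeasure spherical_area E \<le> emeasure spherical_area (Fin -` g -` Fin ` D)"
    using sub by (intro emeasure_mono) auto
  then have area: "(\<integral>\<^sup>+ x. H x \<partial>lborel) \<le> ennreal (256 * k\<^sup>2) * emeasure spherical_area (Fin -` g -` Fin ` D)"
    using H(2) by (meson mult_left_mono order_trans zero_le)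
  have "(\<Sum>\<^sub>\<infinity>y\<in>g -` {Fin x}. of_nat (multiplicity_at g y) * epowr (spherical_deriv g y) (- 2)) \<le> H x"
    if x: "x \<in> D - N" for x
  proof (rule infsum_ennreal_le)
    fix F assume F: "finite F" "F \<subseteq> g -` {Fin x}"
    define F' where "F' = Fin -` F"
    \<comment> \<open>Removing the image of \<open>Infty\<close> and the critical values makes the
      whole fibre finite-valued in the coordinate and noncritical.\<close>
    have finE: "\<exists>z. y = Fin z \<and> z \<in> E \<and> f z = x" if "g y = Fin x" for y
    proof (cases y)
      case (Fin z)
      then have z: "z \<in> E\<^sub>0" "f z = x"
        using that by (auto simp: g E\<^sub>0_def f_def split: if_splits)
      moreover have "z \<notin> C" using x z by (auto simp: N_def)
      ultimately show ?thesis using Fin x by (auto simp: E_def)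
    qed (use that x in \<open>auto simp: N_def\<close>)
    have F': "finite F'" "F' \<subseteq> {z \<in> E. f z = x}"
      using F finE by (auto simp: F'_def inj_def intro!: finite_vimageI)
    have "F = Fin ` F'"
    proof
      show "F \<subseteq> Fin ` F'" using F finE by (fastforce simp: F'_def)
    qed (auto simp: F'_def)
    then have "(\<Sum>y\<in>F. of_nat (multiplicity_at g y) * epowr (spherical_deriv g y) (- 2))
        = (\<Sum>z\<in>F'. of_nat (multiplicity_at g (Fin z)) * epowr (spherical_deriv g (Fin z)) (- 2))"
      by (simp add: sum.reindex inj_on_def)
    also have "\<dots> = (\<Sum>z\<in>F'. ennreal (((1 + (cmod x)\<^sup>2) / (cmod (deriv f z) * (1 + (cmod z)\<^sup>2)))\<^sup>2))"
    proof (rule sum.cong[OF refl])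
      fix z assume "z \<in> F'"
      then have z: "z \<in> E" "f z = x" using F' by auto
      have "ratio_map P Q (Fin z) = Fin x" using z by (auto simp: E_def E\<^sub>0_def f_def)
      moreover have "deriv (\<lambda>w. poly P w / poly Q w) z \<noteq> 0" using z by (auto simp: E_def C_def f_def)
      ultimately show "of_nat (multiplicity_at g (Fin z)) * epowr (spherical_deriv g (Fin z)) (- 2)
          = ennreal (((1 + (cmod x)\<^sup>2) / (cmod (deriv f z) * (1 + (cmod z)\<^sup>2)))\<^sup>2)"
        unfolding g f_def by (rule poincare_term_ratio_map)
    qed
    also have "\<dots> \<le> H x" by (rule H(3)[OF F'])
    finally show "(\<Sum>y\<in>F. of_nat (multiplicity_at g y) * epowr (spherical_deriv g y) (- 2)) \<le> H x" .
  qed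
  then show ?thesis using that H(1) N area by blast
qed

text \<open>Null sets of \<open>sphere_measure\<close> are Borel by definition, so the image of
  \<open>A\<close> is first recognised as a preimage under the continuous \<open>finite_part\<close>
  off \<open>Infty\<close>.\<close>

lemma Fin_image_null_set:
  assumes "A \<in> null_sets lborel"
  shows "Fin ` A \<in> null_sets sphere_measure"
proof -
  have A: "A \<in> sets borel" using assms by (simp add: null_sets_def)
  have "finite_part \<in> borel_measurable (restrict_space borel (- {Infty}))"
    by (rule borel_measurable_continuous_on_restrict[OF continuous_on_finite_part])
  then have "finite_part -` A \<inter> space (restrict_space borel (- {Infty})) \<in> sets (restrict_space borel (- {Infty}))"
    using A by (rule measurable_sets)
  also have "finite_part -` A \<inter> space (restrict_space borel (- {Infty})) = Fin ` A"
  proof (intro set_eqI iffI)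
    fix p assume "p \<in> finite_part -` A \<inter> space (restrict_space borel (- {Infty}))"
    then show "p \<in> Fin ` A" by (cases p) (auto simp: space_restrict_space)
  qed (auto simp: space_restrict_space)
  finally have FA: "Fin ` A \<in> sets borel"
    by (subst (asm) sets_restrict_space_iff) auto
  have "Fin \<in> borel_measurable borel" by (rule borel_measurable_continuous_onI[OF continuous_on_Fin])
  then have "emeasure sphere_measure (Fin ` A) =
      (\<integral>\<^sup>+ z. ennreal (4 / (1 + (cmod z)\<^sup>2)\<^sup>2) * indicator A z \<partial>lborel)"
    unfolding sphere_measure_def using A FA
    by (subst emeasure_distr) (auto simp: emeasure_density inj_vimage_image_eq inj_def)
  also have "\<dots> = 0" using assms by (rule nn_integral_null_set)
  finally show ?thesis using FA by (simp add: null_sets_def sphere_measure_def)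
qed

text \<open>The preimages of the disc-like set \<open>D\<close> under distinct elements of
  \<open>G\<close> are disjoint by \<open>wandering_disjoint\<close>, so the integrals of all
  majorants add up to at most a constant times the finite total area. The exceptional values of
  countably many maps form a null set.\<close>

lemma (in osc_semigroup) poincare_series_AE_finite:
  assumes D: "bounded D" "open D" and sub: "Fin ` D \<subseteq> U"
    and wander: "\<And>g y. g \<in> G \<Longrightarrow> y \<in> Fin ` D \<Longrightarrow> g y \<notin> Fin ` D"
  shows "AE x in lborel. x \<in> D \<longrightarrow> poincare_series G 2 (Fin x) < \<infinity>"
proof -
  obtain r where r: "\<And>x. x \<in> D \<Longrightarrow> cmod x \<le> r" using D(1) by (auto simp: bounded_iff)
  \<comment> \<open>Boundedness of \<open>D\<close> yields one \<open>k\<close>, and hence one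
    constant, for all \<open>g\<close>.\<close>
  define k where "k = 1 + r\<^sup>2"
  have k: "1 + (cmod x)\<^sup>2 \<le> k" if "x \<in> D" for x
    using power_mono[OF r[OF that], of 2] by (simp add: k_def)
  define majorant where "majorant g H N \<longleftrightarrow> H \<in> borel_measurable borel \<and> countable N \<and>
    (\<integral>\<^sup>+ x. H x \<partial>lborel) \<le> ennreal (256 * k\<^sup>2) * emeasure spherical_area (Fin -` g -` Fin ` D) \<and>
    (\<forall>x\<in>D - N. (\<Sum>\<^sub>\<infinity>y\<in>g -` {Fin x}. of_nat (multiplicity_at g y) * epowr (spherical_deriv g y) (- 2)) \<le> H x)"
    for g H and N :: "complex set"
  have "\<exists>H N. majorant g H N"
    if g: "g \<in> G" for g
  proof -
    obtain P Q where PQ: "coprime P Q" "g = ratio_map P Q" using rational_G[OF g] by (auto simp: rational_map_def)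
    show ?thesis
    proof (rule ratio_map_majorant[OF PQ nonconstant_G[OF g] D(2) k])
      fix H :: "complex \<Rightarrow> ennreal" and N
      assume *: "H \<in> borel_measurable borel" "countable N"
        "(\<integral>\<^sup>+ x. H x \<partial>lborel) \<le> ennreal (256 * k\<^sup>2) * emeasure spherical_area (Fin -` g -` Fin ` D)"
        "\<And>x. x \<in> D - N \<Longrightarrow>
          (\<Sum>\<^sub>\<infinity>y\<in>g -` {Fin x}. of_nat (multiplicity_at g y) * epowr (spherical_deriv g y) (- 2)) \<le> H x"
      show ?thesis
        unfolding majorant_def by (intro exI[of _ H] exI[of _ N] conjI ballI *)
    qed
  qed
  then obtain H N where "\<And>g. g \<in> G \<Longrightarrow> majorant g (H g) (N g)" by metis
  then have HN: "\<And>g. g \<in> G \<Longrightarrow> H g \<in> borel_measurable borel" "\<And>g. g \<in> G \<Longrightarrow> countable (N g)"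
    "\<And>g. g \<in> G \<Longrightarrow> (\<integral>\<^sup>+ x. H g x \<partial>lborel) \<le> ennreal (256 * k\<^sup>2) * emeasure spherical_area (Fin -` g -` Fin ` D)"
    "\<And>g x. g \<in> G \<Longrightarrow> x \<in> D - N g \<Longrightarrow>
      (\<Sum>\<^sub>\<infinity>y\<in>g -` {Fin x}. of_nat (multiplicity_at g y) * epowr (spherical_deriv g y) (- 2)) \<le> H g x"
    by (simp_all add: majorant_def)
  define e where "e = from_nat_into G"
  define I where "I = to_nat_on G ` G"
  have e: "e (to_nat_on G g) = g" "to_nat_on G g \<in> I" if "g \<in> G" for g
    using that countable_G by (auto simp: e_def I_def)
  have eG: "e n \<in> G" "to_nat_on G (e n) = n" if "n \<in> I" for n
    using that e by (auto simp: I_def)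
  define S where "S n = (if n \<in> I then Fin -` e n -` Fin ` D else {})" for n
  define H' where "H' n x = (if n \<in> I then H (e n) x else 0)" for n x
  have S: "S n \<in> sets borel" for n
    unfolding S_def using eG rational_G rational_map_continuous_on
    by (auto intro!: borel_open open_vimage_Fin open_vimage open_Fin_image D(2))
  have "disjoint_family S"
    unfolding disjoint_family_on_def
  proof (intro ballI impI)
    fix i j :: nat assume "i \<noteq> j"
    show "S i \<inter> S j = {}"
    proof (rule ccontr)
      assume "S i \<inter> S j \<noteq> {}"
      then obtain y where y: "i \<in> I" "j \<in> I" "e i (Fin y) \<in> Fin ` D" "e j (Fin y) \<in> Fin ` D"
        by (auto simp: S_def split: if_splits)
      have "e i = e j"
        by (rule wandering_disjoint[of "Fin ` D" _ _ "Fin y"]) (use sub wander eG y in blast)+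
      then show False using eG(2) y \<open>i \<noteq> j\<close> by metis
    qed
  qed
  then have sumS: "(\<Sum>n. emeasure spherical_area (S n)) = emeasure spherical_area (\<Union>n. S n)"
    by (rule suminf_emeasure[rotated]) (use S in auto)
  have H'_meas: "H' n \<in> borel_measurable borel" for n
    using HN(1) eG by (cases "n \<in> I") (simp_all add: H'_def[abs_def])
  have "(\<integral>\<^sup>+ x. (\<Sum>n. H' n x) \<partial>lborel) = (\<Sum>n. \<integral>\<^sup>+ x. H' n x \<partial>lborel)"
    using H'_meas by (intro nn_integral_suminf) simp
  also have "\<dots> \<le> (\<Sum>n. ennreal (256 * k\<^sup>2) * emeasure spherical_area (S n))"
    using HN(3) eG by (intro suminf_le) (auto simp: H'_def S_def)
  also have "\<dots> = ennreal (256 * k\<^sup>2) * emeasure spherical_area (\<Union>n. S n)"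
    by (simp add: sumS)
  also have "\<dots> < \<infinity>"
    using emeasure_spherical_area_finite[of "\<Union>n. S n"] by (simp add: ennreal_mult_less_top)
  finally have "(\<integral>\<^sup>+ x. (\<Sum>n. H' n x) \<partial>lborel) \<noteq> \<infinity>" by simp
  then have "AE x in lborel. (\<Sum>n. H' n x) \<noteq> \<infinity>"
    using H'_meas by (intro nn_integral_PInf_AE) auto
  moreover have "countable (\<Union>g\<in>G. N g)" using countable_G HN(2) by auto
  then have "AE x in lborel. x \<notin> (\<Union>g\<in>G. N g)"
    by (intro AE_not_in countable_imp_null_set_lborel)
  ultimately show ?thesis
  proof eventually_elim
    case (elim x)
    show ?case
    proof
      assume x: "x \<in> D"
      have "poincare_series G 2 (Fin x) \<le> (\<Sum>n. H' n x)"
        unfolding poincare_series_def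
      proof (rule infsum_ennreal_le)
        fix F assume F: "finite F" "F \<subseteq> G"
        have "(\<Sum>g\<in>F. \<Sum>\<^sub>\<infinity>y\<in>g -` {Fin x}. of_nat (multiplicity_at g y) * epowr (spherical_deriv g y) (- 2))
            \<le> (\<Sum>g\<in>F. H' (to_nat_on G g) x)"
          using F(2) x elim(2) e HN(4) by (intro sum_mono) (auto simp: H'_def subset_iff)
        also have "\<dots> = (\<Sum>n\<in>to_nat_on G ` F. H' n x)"
          using F(2) countable_G by (subst sum.reindex) (auto intro: inj_on_subset[OF inj_on_to_nat_on])
        also have "\<dots> \<le> (\<Sum>n. H' n x)" using F(1) by (intro sum_le_suminf) auto
        finally show "(\<Sum>g\<in>F. \<Sum>\<^sub>\<infinity>y\<in>g -` {Fin x}. of_nat (multiplicity_at g y) * epowr (spherical_deriv g y) (- 2))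
            \<le> (\<Sum>n. H' n x)" .
      qed
      then show "poincare_series G 2 (Fin x) < \<infinity>" using elim(1) by (simp add: less_top le_less_trans)
    qed
  qed
qed

theorem proposition1p27:
  fixes m :: nat
    and h :: "nat \<Rightarrow> riemann_sphere \<Rightarrow> riemann_sphere"
    and G :: "(riemann_sphere \<Rightarrow> riemann_sphere) set"
    and U :: "riemann_sphere set"
  assumes "m \<ge> 1"
    and "rational_semigroup G"
    and "G = generated_semigroup (h ` {1..m})"
    and "m = 1 \<Longrightarrow> h 1 \<noteq> id \<and> \<not> elliptic (h 1)"
    and "open_set_condition m h U"
    and "Julia G \<noteq> closure U"
  shows "(\<exists>V. open V \<and> V \<noteq> {} \<and> V \<subseteq> U \<inter> Fatou G \<and>
              (AE x in sphere_measure. x \<in> V \<longrightarrow> poincare_series G 2 x < \<infinity>))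
         \<and> s\<^sub>0 G \<le> 2"
proof -
  interpret osc_semigroup m h G U
    using assms by unfold_locales
  obtain V\<^sub>0 where V0: "open V\<^sub>0" "V\<^sub>0 \<noteq> {}" "V\<^sub>0 \<subseteq> \<Omega>" "\<And>g y. g \<in> G \<Longrightarrow> y \<in> V\<^sub>0 \<Longrightarrow> g y \<notin> V\<^sub>0"
    using exists_wandering[OF assms(4) assms(6)] by blast
  obtain z r where r: "r > 0" "ball z r \<subseteq> Fin -` V\<^sub>0"
    using vimage_Fin_nonempty[OF V0(1,2)] open_vimage_Fin[OF V0(1)] open_contains_ball by blast
  \<comment> \<open>A disc is bounded, whereas \<open>V\<^sub>0\<close> may contain
    \<open>Infty\<close>; a part of a wandering set is again wandering.\<close>
  define D where "D = ball z r"
  have D: "open D" "bounded D" "Fin ` D \<subseteq> V\<^sub>0" "z \<in> D" using r by (auto simp: D_def)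
  have AE: "AE x in lborel. x \<in> D \<longrightarrow> poincare_series G 2 (Fin x) < \<infinity>"
  proof (rule poincare_series_AE_finite[OF D(2,1)])
    show "Fin ` D \<subseteq> U" using D(3) V0(3) by (auto simp: \<Omega>_def)
    show "g y \<notin> Fin ` D" if "g \<in> G" "y \<in> Fin ` D" for g y
      using V0(4)[OF that(1) subsetD[OF D(3) that(2)]] D(3) by blast
  qed
  then obtain A where A: "{x. \<not> (x \<in> D \<longrightarrow> poincare_series G 2 (Fin x) < \<infinity>)} \<subseteq> A" "A \<in> null_sets lborel"
    by (auto elim!: AE_E simp: null_sets_def)
  have "AE x in sphere_measure. x \<in> Fin ` D \<longrightarrow> poincare_series G 2 x < \<infinity>"
    by (rule AE_I'[OF Fin_image_null_set[OF A(2)]]) (use A(1) in auto)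
  moreover have "open (Fin ` D)" "Fin ` D \<noteq> {}" "Fin ` D \<subseteq> U \<inter> Fatou G"
    using D V0(3) open_Fin_image by (auto simp: \<Omega>_def)
  moreover have "s\<^sub>0 G \<le> 2"
  proof -
    \<comment> \<open>A disc is not a null set, so the series is finite at some point, and one point
      suffices to bound the infimum.\<close>
    have "\<not> D \<subseteq> A"
    proof
      assume "D \<subseteq> A"
      then have "D \<in> null_sets lborel" using A(2) D(1) by (auto intro: null_sets_subset)
      then have "negligible D" by (simp add: negligible_iff_null_sets null_sets_completionI)
      then show False using open_not_negligible[OF D(1)] D(4) by blast
    qed
    then obtain x where "poincare_series G 2 (Fin x) < \<infinity>" using A(1) by blast
    then have "critical_exponent_at G (Fin x) \<le> ereal 2"
      unfolding critical_exponent_at_def by (intro Inf_lower) auto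
    then show ?thesis unfolding s\<^sub>0_def by (intro INF_lower2[of "Fin x"]) auto
  qed
  ultimately show ?thesis by blast
qed

end
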